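(* Let $X$ be an infinite-dimensional complex Banach space. Then the set \[\left\{T\in\mathcal{L}(X): T\text{ admits an almost-invariant halfspace of defect}\leq 1\right\}\] is norm-dense in $\mathcal{L}(X)$.
   Context: $\mathcal{L}(X)$ denotes the algebra of all continuous linear operators on $X$, with the operator norm. A halfspace of $X$ is a closed subspace of $X$ with both infinite dimension and infinite codimension in $X$. A subspace $Y$ of $X$ is almost-invariant under $T$ if $TY\subseteq Y+E$ for some finite-dimensional subspace $E$ of $X$; the smallest possible dimension of such an $E$ is called the defect. *)

theory Defs
  imports "HOL-Analysis.Analysis"
begin

class scaleC = scaleR +
  fixes scaleC :: "complex \<Rightarrow> 'a \<Rightarrow> 'a" (infixr "*\<^sub>C" 75)
  assumes scaleR_scaleC: "r *\<^sub>R x = complex_of_real r *\<^sub>C x"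

class complex_vector = scaleC + ab_group_add +
  assumes scaleC_add_right: "a *\<^sub>C (x + y) = a *\<^sub>C x + a *\<^sub>C y"
    and scaleC_add_left: "(a + b) *\<^sub>C x = a *\<^sub>C x + b *\<^sub>C x"
    and scaleC_scaleC: "a *\<^sub>C b *\<^sub>C x = (a * b) *\<^sub>C x"
    and scaleC_one: "1 *\<^sub>C x = x"

text \<open>The underlying real normed space is inherited, so that the topology, completeness and the
  bounded operators of the library are available.\<close>

class complex_normed_vector = complex_vector + real_normed_vector +
  assumes norm_scaleC: "norm (a *\<^sub>C x) = cmod a * norm x"

class complex_banach = complex_normed_vector + banach

instantiation complex :: complex_banach
begin

definition scaleC_complex :: "complex \<Rightarrow> complex \<Rightarrow> complex"
  where "scaleC_complex a x = a * x"

instance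
  by standard (auto simp: scaleC_complex_def scaleR_conv_of_real algebra_simps norm_mult)

end

global_interpretation complex_vector: vector_space "scaleC :: complex \<Rightarrow> 'a \<Rightarrow> 'a::complex_vector"
  defines csubspace = complex_vector.subspace
    and cspan = complex_vector.span
    and cdependent = complex_vector.dependent
    and cdim = complex_vector.dim
    and crepresentation = complex_vector.representation
    and cextend_basis = complex_vector.extend_basis
  by unfold_locales (simp_all add: scaleC_add_right scaleC_add_left scaleC_scaleC scaleC_one)

definition finite_cdim :: "'a::complex_vector set \<Rightarrow> bool"
  where "finite_cdim V \<longleftrightarrow> (\<exists>B. finite B \<and> cspan B = V)"

text \<open>The quotient by \<open>Y\<close> is finite-dimensional iff it is spanned by the cosets of finitely many
  vectors \<open>b \<in> B\<close>, that is, iff every vector lies in \<open>Y + cspan B\<close>. Below, \<open>+\<close> on sets is the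
  elementwise sum.\<close>

definition finite_ccodim :: "'a::complex_vector set \<Rightarrow> bool"
  where "finite_ccodim Y \<longleftrightarrow> (\<exists>B. finite B \<and> Y + cspan B = UNIV)"

definition halfspace :: "'a::complex_normed_vector set \<Rightarrow> bool"
  where "halfspace Y \<longleftrightarrow> csubspace Y \<and> closed Y \<and> \<not> finite_cdim Y \<and> \<not> finite_ccodim Y"

text \<open>Elements of \<^typ>\<open>'a \<Rightarrow>\<^sub>L 'a\<close> are only real-linear, so complex linearity has to be imposed. The
  norm of \<^typ>\<open>'a \<Rightarrow>\<^sub>L 'a\<close> is the supremum of \<open>norm (T x) / norm x\<close>, and hence restricts to the
  usual operator norm on the complex-linear operators.\<close>

definition clinear_operators :: "('a::complex_normed_vector \<Rightarrow>\<^sub>L 'a) set"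
  where "clinear_operators = {T. Vector_Spaces.linear scaleC scaleC (blinfun_apply T)}"

definition almost_invariant_with ::
    "('a::complex_normed_vector \<Rightarrow>\<^sub>L 'a) \<Rightarrow> 'a set \<Rightarrow> 'a set \<Rightarrow> bool"
  where "almost_invariant_with T Y E \<longleftrightarrow>
    csubspace E \<and> finite_cdim E \<and> blinfun_apply T ` Y \<subseteq> Y + E"

definition almost_invariant :: "('a::complex_normed_vector \<Rightarrow>\<^sub>L 'a) \<Rightarrow> 'a set \<Rightarrow> bool"
  where "almost_invariant T Y \<longleftrightarrow> (\<exists>E. almost_invariant_with T Y E)"

text \<open>Only meaningful if \<open>almost_invariant T Y\<close>.\<close>

definition defect :: "('a::complex_normed_vector \<Rightarrow>\<^sub>L 'a) \<Rightarrow> 'a set \<Rightarrow> nat"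
  where "defect T Y = (LEAST d. \<exists>E. almost_invariant_with T Y E \<and> cdim E = d)"

end

theory Submission
  imports Defs
begin

text \<open>
  Every bounded operator \<open>T\<close> on an infinite-dimensional complex Banach space has an arbitrarily small
  perturbation with an infinite-dimensional eigenspace; half of that eigenspace is then an
  invariant halfspace, so even defect 0 is attained on a dense set.

  The perturbation needs a scalar \<open>l\<close> such that \<open>l - T\<close> is not bounded below on any closed subspace of
  finite codimension (\<open>essential_approximate_eigenvalue\<close>). Classically, such an \<open>l\<close> exists because
  the operator induced by \<open>T\<close> on a suitable quotient of \<open>\<ell>\<^sup>\<infinity>(X)\<close> has an approximate eigenvalue on
  the boundary of its spectrum. Here the quotient is replaced by a filter, \<open>ess\<close>, generated by the
  finite-codimensional subspaces, and the spectral argument is carried out without resolvents. If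
  \<open>l - T\<close> were essentially bounded below for all \<open>l\<close>, a discrete Cauchy formula over roots of unity
  would make the averages \<open>r ^ n / (r ^ n - T ^ n)\<close> depend on \<open>r\<close> in a Lipschitz way, uniformly in \<open>n\<close>
  (\<open>two_radii_estimate\<close>, with denominators cleared). But for large \<open>n\<close> these averages drop from the
  identity to something small as \<open>r\<close> passes the essential spectral radius from above.

  Given \<open>l\<close>, vectors \<open>x n\<close> and functionals \<open>f n\<close> are chosen inductively so that they are biorthogonal
  and \<open>l x n - T x n\<close> is as small as desired compared with the norm of \<open>f n\<close>
  (\<open>biorthogonal_small_sequence\<close>). The functionals come from the Hahn-Banach theorem, proved here
  by Zorn's lemma applied to sublinear functionals (\<open>linear_below_sublinear\<close>). The operator
  \<open>K y = (\<Sum>n. f n y *\<^sub>C (l x n - T x n))\<close> is then small, and \<open>T + K\<close> maps every \<open>x n\<close> to \<open>l x n\<close>. The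
  eigenvectors of \<open>T + K\<close> for \<open>l\<close> that are annihilated by the functionals of odd index form the
  required halfspace (\<open>eigenvectors_halfspace\<close>).
\<close>

section \<open>Sublinear functionals and norming functionals\<close>

definition sublinear :: "('a::real_vector \<Rightarrow> real) \<Rightarrow> bool"
  where "sublinear p \<longleftrightarrow>
    (\<forall>x y. p (x + y) \<le> p x + p y) \<and> (\<forall>t x. 0 < t \<longrightarrow> p (t *\<^sub>R x) = t * p x)"

lemma sublinear_zero: "sublinear p \<Longrightarrow> p 0 = 0"
proof -
  assume "sublinear p"
  then have "p (2 *\<^sub>R 0) = 2 * p 0"
    unfolding sublinear_def by (metis zero_less_numeral)
  then show ?thesis by simp
qed

lemma sublinear_neg_le: "sublinear p \<Longrightarrow> - p (- x) \<le> p x"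
proof -
  assume p: "sublinear p"
  then have "p (x + - x) \<le> p x + p (- x)"
    unfolding sublinear_def by blast
  then show ?thesis using sublinear_zero[OF p] by simp
qed

lemma sublinear_scale: "sublinear p \<Longrightarrow> 0 \<le> t \<Longrightarrow> p (t *\<^sub>R x) = t * p x"
  using sublinear_zero[of p] by (cases "t = 0") (auto simp: sublinear_def)

text \<open>\<open>q x\<close> is the infimum over \<open>t \<ge> 0\<close> of \<open>p (x + t a) - t p a\<close>: the largest sublinear functional below
\<open>p\<close> that satisfies the last claim. The value \<open>t = 0\<close> gives \<open>q \<le> p\<close>, and \<open>t = 1\<close> at \<open>- a\<close> gives that
claim. This is the only step of the Hahn-Banach argument that touches a single vector: it shows
that a minimal sublinear functional is odd, and it turns the norm into a functional whose linear
minorants attain the norm at \<open>a\<close>.\<close>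

lemma sublinear_lower_along:
  fixes p :: "'a::real_vector \<Rightarrow> real"
  assumes p: "sublinear p"
  obtains q where "sublinear q" "\<And>x. q x \<le> p x" "q (- a) \<le> - p a"
proof
  define S where "S x = (\<lambda>t. p (x + t *\<^sub>R a) - t * p a) ` {0..}" for x
  define q where "q x = Inf (S x)" for x
  have add: "p (x + y) \<le> p x + p y" for x y
    using p unfolding sublinear_def by blast
  have bound: "- p (- x) \<le> s" if "s \<in> S x" for s x
  proof -
    obtain t where t: "0 \<le> t" and s: "s = p (x + t *\<^sub>R a) - t * p a"
      using \<open>s \<in> S x\<close> unfolding S_def by auto
    have "p (x + t *\<^sub>R a + - x) \<le> p (x + t *\<^sub>R a) + p (- x)" by (rule add)
    then show ?thesis using sublinear_scale[OF p t, of a] s by simp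
  qed
  then have bdd: "bdd_below (S x)" for x by (meson bdd_belowI)
  have ne: "S x \<noteq> {}" for x unfolding S_def by auto
  have q_le: "q x \<le> p (x + t *\<^sub>R a) - t * p a" if "0 \<le> t" for t x
    unfolding q_def by (rule cInf_lower[OF _ bdd]) (use that in \<open>auto simp: S_def\<close>)
  show "q x \<le> p x" for x using q_le[of 0 x] by simp
  show "q (- a) \<le> - p a" using q_le[of 1 "- a"] sublinear_zero[OF p] by simp
  have q_geI: "z \<le> q x" if "\<And>t. 0 \<le> t \<Longrightarrow> z \<le> p (x + t *\<^sub>R a) - t * p a" for z x
    unfolding q_def by (rule cInf_greatest[OF ne]) (use that in \<open>auto simp: S_def\<close>)
  have q_add: "q (x + y) \<le> q x + q y" for x y
  proof -
    have "q (x + y) - (p (x + t *\<^sub>R a) - t * p a) \<le> p (y + s *\<^sub>R a) - s * p a"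
      if t: "0 \<le> t" and s: "0 \<le> s" for s t
    proof -
      have "q (x + y) \<le> p ((x + y) + (t + s) *\<^sub>R a) - (t + s) * p a"
        by (rule q_le) (use t s in simp)
      moreover have "p ((x + y) + (t + s) *\<^sub>R a) \<le> p (x + t *\<^sub>R a) + p (y + s *\<^sub>R a)"
        using add[of "x + t *\<^sub>R a" "y + s *\<^sub>R a"] by (simp add: algebra_simps)
      ultimately show ?thesis by (simp add: algebra_simps)
    qed
    then have "q (x + y) - (p (x + t *\<^sub>R a) - t * p a) \<le> q y" if "0 \<le> t" for t
      using that by (intro q_geI)
    then have "q (x + y) - q y \<le> q x"
      by (intro q_geI) (simp add: algebra_simps)
    then show ?thesis by simp
  qed
  have q_scale_le: "q (r *\<^sub>R x) \<le> r * q x" if r: "0 < r" for r x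
  proof -
    have "q (r *\<^sub>R x) / r \<le> p (x + t *\<^sub>R a) - t * p a" if t: "0 \<le> t" for t
    proof -
      have "q (r *\<^sub>R x) \<le> p (r *\<^sub>R x + (r * t) *\<^sub>R a) - (r * t) * p a"
        by (rule q_le) (use r t in simp)
      also have "r *\<^sub>R x + (r * t) *\<^sub>R a = r *\<^sub>R (x + t *\<^sub>R a)"
        by (simp add: algebra_simps)
      also have "p \<dots> = r * p (x + t *\<^sub>R a)"
        using r by (intro sublinear_scale[OF p]) simp
      finally show ?thesis using r by (simp add: field_simps)
    qed
    then have "q (r *\<^sub>R x) / r \<le> q x" by (rule q_geI)
    then show ?thesis using r by (simp add: field_simps)
  qed
  have "q (r *\<^sub>R x) = r * q x" if r: "0 < r" for r x
  proof (rule antisym[OF q_scale_le[OF r]])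
    have "q (inverse r *\<^sub>R r *\<^sub>R x) \<le> inverse r * q (r *\<^sub>R x)"
      by (rule q_scale_le) (use r in simp)
    then show "r * q x \<le> q (r *\<^sub>R x)" using r by (simp add: field_simps)
  qed
  then show "sublinear q" unfolding sublinear_def using q_add by blast
qed

text \<open>Lower bounds of chains for Zorn's lemma. The pointwise infimum is finite because every member
\<open>q \<le> p\<close> satisfies \<open>q x \<ge> - q (- x) \<ge> - p (- x)\<close>.\<close>

lemma sublinear_Inf_chain:
  fixes C :: "('a::real_vector \<Rightarrow> real) set"
  assumes C: "C \<noteq> {}" "\<And>q. q \<in> C \<Longrightarrow> sublinear q"
    and chain: "\<And>q r. q \<in> C \<Longrightarrow> r \<in> C \<Longrightarrow> q \<le> r \<or> r \<le> q"
    and low: "\<And>q. q \<in> C \<Longrightarrow> q \<le> p"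
  shows "sublinear (\<lambda>x. INF q\<in>C. q x)" and "q \<in> C \<Longrightarrow> (INF q\<in>C. q x) \<le> q x"
proof -
  let ?u = "\<lambda>x. INF q\<in>C. q x"
  have bdd: "bdd_below ((\<lambda>q. q x) ` C)" for x
  proof (rule bdd_belowI2)
    show "- p (- x) \<le> q x" if "q \<in> C" for q
      using sublinear_neg_le[OF C(2)[OF that], of x] le_funD[OF low[OF that], of "- x"] by linarith
  qed
  have le: "?u x \<le> q x" if "q \<in> C" for q x
    by (rule cINF_lower[OF bdd that])
  then show "q \<in> C \<Longrightarrow> (INF q\<in>C. q x) \<le> q x" .
  have geI: "z \<le> ?u x" if "\<And>q. q \<in> C \<Longrightarrow> z \<le> q x" for z x
    by (rule cINF_greatest[OF C(1) that])
  have "?u (x + y) \<le> ?u x + ?u y" for x y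
  proof -
    have "?u (x + y) \<le> q x + r y" if qr: "q \<in> C" "r \<in> C" for q r
    proof -
      \<comment> \<open>Along a chain the smaller of \<open>q\<close> and \<open>r\<close> serves both summands.\<close>
      obtain s where s: "s \<in> C" "s \<le> q" "s \<le> r" using chain[OF qr] qr by blast
      have "?u (x + y) \<le> s (x + y)" by (rule le[OF s(1)])
      also have "\<dots> \<le> s x + s y" using C(2)[OF s(1)] unfolding sublinear_def by blast
      finally show ?thesis using s(2,3) by (smt (verit) le_funD)
    qed
    then have "?u (x + y) - r x \<le> q y" if "q \<in> C" "r \<in> C" for q r
      using \<open>\<And>q r. q \<in> C \<Longrightarrow> r \<in> C \<Longrightarrow> ?u (x + y) \<le> q x + r y\<close>[OF that(2,1)] by simp
    then have "?u (x + y) - r x \<le> ?u y" if "r \<in> C" for r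
      using that by (intro geI)
    then have "?u (x + y) - ?u y \<le> r x" if "r \<in> C" for r
      using that by (simp add: diff_le_eq add.commute)
    then have "?u (x + y) - ?u y \<le> ?u x" by (rule geI)
    then show ?thesis by simp
  qed
  moreover have scale_le: "r * ?u x \<le> ?u (r *\<^sub>R x)" if r: "0 < r" for r x
  proof (rule geI)
    fix q assume q: "q \<in> C"
    then have "q (r *\<^sub>R x) = r * q x" using C(2) r unfolding sublinear_def by blast
    then show "r * ?u x \<le> q (r *\<^sub>R x)" using le[OF q, of x] r by simp
  qed
  moreover have "?u (r *\<^sub>R x) \<le> r * ?u x" if r: "0 < r" for r x
    using scale_le[of "inverse r" "r *\<^sub>R x"] r by (simp add: field_simps)
  ultimately show "sublinear ?u"
    unfolding sublinear_def by (meson antisym)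
qed

text \<open>The Hahn-Banach theorem in the form that needs no partially defined functionals: a minimal
sublinear functional below \<open>p\<close> cannot be lowered along any direction, hence is odd, hence additive.\<close>

lemma linear_below_sublinear:
  fixes p :: "'a::real_vector \<Rightarrow> real"
  assumes p: "sublinear p"
  obtains h where "linear h" "\<And>x. h x \<le> p x"
proof -
  define A where "A = {q. sublinear q \<and> q \<le> p}"
  have "\<exists>m\<in>A. \<forall>a\<in>A. a \<le> m \<longrightarrow> a = m"
  proof (rule predicate_Zorn[of A "\<lambda>x y. y \<le> x"])
    show "partial_order_on A (relation_of (\<lambda>x y. y \<le> x) A)"
      by (rule partial_order_on_relation_ofI) auto
    fix C assume C: "C \<in> Chains (relation_of (\<lambda>x y. y \<le> x) A)"
    show "\<exists>u\<in>A. \<forall>a\<in>C. u \<le> a"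
    proof (cases "C = {}")
      case True
      then show ?thesis using p by (auto simp: A_def)
    next
      case False
      have CA: "C \<subseteq> A" and ch: "\<And>q r. q \<in> C \<Longrightarrow> r \<in> C \<Longrightarrow> q \<le> r \<or> r \<le> q"
        using C by (auto simp: Chains_def relation_of_def)
      let ?u = "\<lambda>x. INF q\<in>C. q x"
      have sub: "sublinear ?u" and le: "\<And>q x. q \<in> C \<Longrightarrow> ?u x \<le> q x"
        using sublinear_Inf_chain[of C p] False CA ch unfolding A_def by blast+
      have below: "?u \<le> q" if "q \<in> C" for q
        using le[OF that] by (rule le_funI)
      obtain q where q: "q \<in> C" using False by blast
      then have "q \<le> p" using CA by (auto simp: A_def)
      with below[OF q] have "?u \<le> p" by (rule order_trans)
      then have "?u \<in> A" using sub by (simp add: A_def)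
      then show ?thesis using below by blast
    qed
  qed
  then obtain m where m: "sublinear m" "m \<le> p"
    and min: "\<And>a. sublinear a \<Longrightarrow> a \<le> m \<Longrightarrow> a = m"
    unfolding A_def by (blast intro: order_trans)
  have neg: "m (- a) = - m a" for a
  proof -
    obtain q where q: "sublinear q" "\<And>x. q x \<le> m x" "q (- a) \<le> - m a"
      using sublinear_lower_along[OF m(1), of a] by blast
    have "q = m" by (rule min) (use q in \<open>auto simp: le_fun_def\<close>)
    then show ?thesis using q(3) sublinear_neg_le[OF m(1), of "- a"] by simp
  qed
  have add: "m (x + y) = m x + m y" for x y
  proof (rule antisym)
    show "m (x + y) \<le> m x + m y" using m(1) unfolding sublinear_def by blast
    have "m (- x + - y) \<le> m (- x) + m (- y)" using m(1) unfolding sublinear_def by blast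
    then show "m x + m y \<le> m (x + y)" using neg[of "x + y"] neg[of x] neg[of y] by simp
  qed
  have "m (r *\<^sub>R x) = r * m x" for r x
  proof (cases "0 \<le> r")
    case True
    then show ?thesis by (rule sublinear_scale[OF m(1)])
  next
    case False
    then show ?thesis using sublinear_scale[OF m(1), of "- r" x] neg[of "r *\<^sub>R x"] by simp
  qed
  then have "linear m" using add by (intro linearI) auto
  with m(2) show thesis by (intro that) (auto simp: le_fun_def)
qed

lemma real_norming_functional:
  fixes a :: "'a::real_normed_vector"
  obtains h where "linear h" "\<And>x. \<bar>h x\<bar> \<le> norm x" "h a = norm a"
proof -
  have "sublinear (norm :: 'a \<Rightarrow> real)"
    unfolding sublinear_def by (simp add: norm_triangle_ineq)
  then obtain q where q: "sublinear q" "\<And>x. q x \<le> norm x" "q (- a) \<le> - norm a"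
    using sublinear_lower_along[of norm a] by blast
  obtain h where h: "linear h" "\<And>x. h x \<le> q x"
    using linear_below_sublinear[OF q(1)] by blast
  have le: "h x \<le> norm x" for x using h(2) q(2) by (rule order_trans)
  have neg: "h (- x) = - h x" for x by (rule linear_neg[OF h(1)])
  show thesis
  proof (rule that[OF h(1)])
    show "\<bar>h x\<bar> \<le> norm x" for x using le[of x] le[of "- x"] neg[of x] by simp
    show "h a = norm a" using h(2)[of "- a"] q(3) neg[of a] le[of a] by simp
  qed
qed

section \<open>Bounded complex-linear maps\<close>

definition bounded_clinear :: "('a::complex_normed_vector \<Rightarrow> 'b::complex_normed_vector) \<Rightarrow> bool"
  where "bounded_clinear f \<longleftrightarrow> bounded_linear f \<and> (\<forall>c x. f (c *\<^sub>C x) = c *\<^sub>C f x)"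

lemma bounded_linear_scaleC: "bounded_linear ((*\<^sub>C) c :: 'a \<Rightarrow> 'a::complex_normed_vector)"
  by (rule bounded_linear_intro[where K = "cmod c"])
     (simp_all add: scaleC_add_right scaleR_scaleC scaleC_scaleC norm_scaleC mult.commute)

lemma bounded_clinear_bounded_linear: "bounded_clinear f \<Longrightarrow> bounded_linear f"
  by (simp add: bounded_clinear_def)

lemma bounded_clinear_scaleC: "bounded_clinear f \<Longrightarrow> f (c *\<^sub>C x) = c *\<^sub>C f x"
  by (simp add: bounded_clinear_def)

lemma bounded_clinear_linear: "bounded_clinear f \<Longrightarrow> linear f"
  by (simp add: bounded_clinear_def bounded_linear.linear)

lemmas bounded_clinear_simps =
  linear_add[OF bounded_clinear_linear] linear_diff[OF bounded_clinear_linear]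
  linear_0[OF bounded_clinear_linear] bounded_clinear_scaleC

lemma bounded_clinear_intro:
  assumes "\<And>x y. f (x + y) = f x + f y" "\<And>c x. f (c *\<^sub>C x) = c *\<^sub>C f x"
    and "\<And>x. norm (f x) \<le> norm x * K"
  shows "bounded_clinear f"
  unfolding bounded_clinear_def
  using assms by (auto intro!: bounded_linear_intro[where K = K] simp: scaleR_scaleC)

lemma bounded_clinear_ident: "bounded_clinear (\<lambda>x. x)"
  by (rule bounded_clinear_intro[where K = 1]) auto

lemma bounded_clinear_zero: "bounded_clinear (\<lambda>x. 0)"
  by (rule bounded_clinear_intro[where K = 1]) auto

lemma bounded_clinear_compose:
  "bounded_clinear f \<Longrightarrow> bounded_clinear g \<Longrightarrow> bounded_clinear (\<lambda>x. f (g x))"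
  unfolding bounded_clinear_def by (auto intro: bounded_linear_compose)

lemma bounded_clinear_add:
  "bounded_clinear f \<Longrightarrow> bounded_clinear g \<Longrightarrow> bounded_clinear (\<lambda>x. f x + g x)"
  unfolding bounded_clinear_def by (auto intro: bounded_linear_add simp: scaleC_add_right)

lemma bounded_clinear_sub:
  "bounded_clinear f \<Longrightarrow> bounded_clinear g \<Longrightarrow> bounded_clinear (\<lambda>x. f x - g x)"
  unfolding bounded_clinear_def
  by (auto intro: bounded_linear_sub simp: complex_vector.scale_right_diff_distrib)

lemma bounded_clinear_const_scaleC: "bounded_clinear f \<Longrightarrow> bounded_clinear (\<lambda>x. c *\<^sub>C f x)"
  unfolding bounded_clinear_def
  by (auto intro: bounded_linear_compose[OF bounded_linear_scaleC] simp: scaleC_scaleC mult.commute)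

lemma bounded_clinear_scaleC_const:
  fixes f :: "'a::complex_normed_vector \<Rightarrow> complex"
  assumes f: "bounded_clinear f"
  shows "bounded_clinear (\<lambda>x. f x *\<^sub>C v)"
proof -
  obtain K where K: "\<And>x. norm (f x) \<le> norm x * K"
    using bounded_linear.bounded[OF bounded_clinear_bounded_linear[OF f]] by blast
  show ?thesis
  proof (rule bounded_clinear_intro[where K = "K * norm v"])
    show "norm (f x *\<^sub>C v) \<le> norm x * (K * norm v)" for x
      using mult_right_mono[OF K norm_ge_zero[of v], of x] by (simp add: norm_scaleC mult.assoc)
  qed (simp_all add: bounded_clinear_simps[OF f] scaleC_add_left scaleC_scaleC scaleC_complex_def)
qed

lemma bounded_clinear_funpow:
  fixes T :: "'a::complex_normed_vector \<Rightarrow> 'a"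
  assumes "bounded_clinear T"
  shows "bounded_clinear (T ^^ n)"
proof (induction n)
  case 0
  then show ?case using bounded_clinear_ident by (simp add: id_def)
next
  case (Suc n)
  then show ?case using bounded_clinear_compose[OF assms, of "T ^^ n"] by (simp add: o_def)
qed

text \<open>The real functional \<open>h\<close> is complexified to \<open>h x - \<i> h (\<i> x)\<close> and rescaled to take the value 1 at
\<open>a\<close>. The constant 2 is the crude bound of this complexification by the sum of the two parts.\<close>

lemma norming_functional:
  fixes a :: "'a::complex_normed_vector"
  assumes "norm a = 1"
  obtains g :: "'a \<Rightarrow> complex" where "bounded_clinear g" "g a = 1" "\<And>x. cmod (g x) \<le> 2 * norm x"
proof -
  obtain h where h: "linear h" "\<And>x. \<bar>h x\<bar> \<le> norm x" "h a = norm a"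
    using real_norming_functional[of a] by blast
  define f where "f x = Complex (h x) (- h (\<i> *\<^sub>C x))" for x
  have f_add: "f (x + y) = f x + f y" for x y
    by (simp add: f_def linear_add[OF h(1)] scaleC_add_right complex_eq_iff)
  have h_scale: "h (c *\<^sub>C x) = Re c * h x + Im c * h (\<i> *\<^sub>C x)" for c x
  proof -
    have "c = complex_of_real (Re c) + complex_of_real (Im c) * \<i>"
      by (simp add: complex_eq_iff)
    then have "c *\<^sub>C x = (complex_of_real (Re c) + complex_of_real (Im c) * \<i>) *\<^sub>C x"
      by (rule arg_cong)
    then have "c *\<^sub>C x = Re c *\<^sub>R x + Im c *\<^sub>R (\<i> *\<^sub>C x)"
      by (simp only: scaleR_scaleC scaleC_scaleC scaleC_add_left)
    then show ?thesis by (simp add: linear_add[OF h(1)] linear_cmul[OF h(1)])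
  qed
  have f_scale: "f (c *\<^sub>C x) = c *\<^sub>C f x" for c x
    using h_scale[of c x] h_scale[of "\<i> * c" x]
    by (simp add: f_def scaleC_complex_def scaleC_scaleC complex_eq_iff algebra_simps)
  have f_bound: "cmod (f x) \<le> 2 * norm x" for x
  proof -
    have "cmod (f x) \<le> \<bar>h x\<bar> + \<bar>h (\<i> *\<^sub>C x)\<bar>"
      using cmod_le[of "f x"] by (simp add: f_def)
    also have "\<dots> \<le> norm x + norm (\<i> *\<^sub>C x)" by (intro add_mono h(2))
    finally show ?thesis by (simp add: norm_scaleC)
  qed
  have "\<bar>Re (f a)\<bar> \<le> cmod (f a)" by (rule abs_Re_le_cmod)
  then have fa: "1 \<le> cmod (f a)" using h(3) assms by (simp add: f_def)
  have f: "bounded_clinear f"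
    by (rule bounded_clinear_intro[where K = 2])
       (use f_add f_scale f_bound in \<open>auto simp: mult.commute\<close>)
  show thesis
  proof
    show "bounded_clinear (\<lambda>x. inverse (f a) *\<^sub>C f x)"
      by (rule bounded_clinear_const_scaleC[OF f])
    have "f a \<noteq> 0" using fa by force
    then show "inverse (f a) *\<^sub>C f a = 1" by (simp add: scaleC_complex_def)
    show "cmod (inverse (f a) *\<^sub>C f x) \<le> 2 * norm x" for x
    proof -
      have "cmod (inverse (f a) *\<^sub>C f x) = inverse (cmod (f a)) * cmod (f x)"
        by (simp add: scaleC_complex_def norm_mult norm_inverse)
      also have "\<dots> \<le> 1 * cmod (f x)"
        by (rule mult_right_mono) (use fa in \<open>simp_all add: inverse_le_1_iff\<close>)
      finally show ?thesis using f_bound[of x] by simp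
    qed
  qed
qed

section \<open>The filter of closed subspaces of finite codimension\<close>

text \<open>The filter generated by the kernels of continuous functionals, that is, by the closed subspaces of
finite codimension. A property that holds eventually along it is one that holds essentially:
finitely many linear constraints on \<open>x\<close> may be imposed for free. An estimate
\<open>norm (A x) \<le> C * norm x\<close> that holds eventually bounds the essential norm of \<open>A\<close>, and an
estimate from below says that \<open>A\<close> is bounded below up to finite dimensions (upper semi-Fredholm).\<close>

definition ess :: "'a::complex_normed_vector filter"
  where "ess = (INF f\<in>{f :: 'a \<Rightarrow> complex. bounded_clinear f}. principal {x. f x = 0})"

lemma eventually_ess:
  "eventually P ess \<longleftrightarrow>
    (\<exists>F. finite F \<and> (\<forall>f\<in>F. bounded_clinear f) \<and> (\<forall>x. (\<forall>f\<in>F. f x = (0::complex)) \<longrightarrow> P x))"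
proof -
  have fin: "eventually P (INF f\<in>F. principal {x. f x = (0::complex)}) \<longleftrightarrow>
      (\<forall>x. (\<forall>f\<in>F. f x = 0) \<longrightarrow> P x)" if "finite F" for F
    unfolding INF_principal_finite[OF that] eventually_principal by auto
  have "eventually P ess \<longleftrightarrow> (\<exists>F\<subseteq>{f. bounded_clinear f}. finite F \<and>
      eventually P (INF f\<in>F. principal {x. f x = (0::complex)}))"
    unfolding ess_def by (rule eventually_INF)
  also have "\<dots> \<longleftrightarrow> (\<exists>F\<subseteq>{f. bounded_clinear f}. finite F \<and>
      (\<forall>x. (\<forall>f\<in>F. f x = (0::complex)) \<longrightarrow> P x))"
    using fin by (metis (no_types, lifting))
  also have "\<dots> \<longleftrightarrow> (\<exists>F. finite F \<and> (\<forall>f\<in>F. bounded_clinear f) \<and>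
      (\<forall>x. (\<forall>f\<in>F. f x = (0::complex)) \<longrightarrow> P x))"
    by (intro ex_cong1) blast
  finally show ?thesis .
qed

lemma eventually_ess_kernel: "bounded_clinear f \<Longrightarrow> \<forall>\<^sub>F x in ess. f x = (0::complex)"
  unfolding eventually_ess by (intro exI[of _ "{f}"]) auto

text \<open>Bounded complex-linear maps pull finite-codimensional subspaces back to such subspaces. Thus
essential estimates can be applied not only to \<open>x\<close> but also to images of \<open>x\<close> under polynomials in an
operator.\<close>

lemma eventually_ess_compose:
  assumes "bounded_clinear A" "eventually P ess"
  shows "\<forall>\<^sub>F x in ess. P (A x)"
proof -
  obtain F where F: "finite F" "\<forall>f\<in>F. bounded_clinear f"
      "\<forall>x. (\<forall>f\<in>F. f x = (0::complex)) \<longrightarrow> P x"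
    using assms(2) unfolding eventually_ess by blast
  let ?G = "(\<lambda>f x. f (A x)) ` F"
  have "finite ?G" using F(1) by simp
  moreover have "\<forall>g\<in>?G. bounded_clinear g"
    using F(2) bounded_clinear_compose[OF _ assms(1)] by blast
  moreover have "\<forall>x. (\<forall>g\<in>?G. g x = 0) \<longrightarrow> P (A x)" using F(3) by simp
  ultimately show ?thesis unfolding eventually_ess by blast
qed

text \<open>Each functional costs at most one additional dimension in the complement.\<close>

lemma kernel_complement:
  assumes "finite F" "\<And>f. f \<in> F \<Longrightarrow> bounded_clinear f"
  shows "\<exists>B. finite B \<and> (\<forall>x. \<exists>y\<in>cspan B. \<forall>f\<in>F. f (x - y) = (0::complex))"
  using assms
proof (induction F rule: finite_induct)
  case empty
  then show ?case by (intro exI[of _ "{}"]) auto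
next
  case (insert f F)
  then obtain B where B: "finite B" "\<And>x. \<exists>y\<in>cspan B. \<forall>g\<in>F. g (x - y) = 0"
    by auto
  have lin: "\<And>g. g \<in> insert f F \<Longrightarrow> bounded_clinear g" by (rule insert.prems)
  show ?case
  proof (cases "\<forall>x. (\<forall>g\<in>F. g x = 0) \<longrightarrow> f x = 0")
    case True
    then show ?thesis using B by (intro exI[of _ B]) blast
  next
    case False
    then obtain b where b: "\<And>g. g \<in> F \<Longrightarrow> g b = 0" "f b \<noteq> 0" by blast
    have "\<exists>y\<in>cspan (insert b B). \<forall>g\<in>insert f F. g (x - y) = 0" for x
    proof -
      obtain y where y: "y \<in> cspan B" "\<And>g. g \<in> F \<Longrightarrow> g (x - y) = 0" using B(2) by blast
      define c where "c = f (x - y) / f b"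
      have split: "x - (y + c *\<^sub>C b) = (x - y) - c *\<^sub>C b" by simp
      have "g (x - (y + c *\<^sub>C b)) = 0" if g: "g \<in> insert f F" for g
      proof (cases "g = f")
        case True
        then show ?thesis unfolding split
          by (subst linear_diff[OF bounded_clinear_linear[OF lin[OF g]]])
             (use b(2) True in \<open>simp add: bounded_clinear_scaleC[OF lin] c_def scaleC_complex_def\<close>)
      next
        case False
        then have "g \<in> F" using g by simp
        then show ?thesis unfolding split
          by (subst linear_diff[OF bounded_clinear_linear[OF lin[OF g]]])
             (simp add: bounded_clinear_scaleC[OF lin[OF g]] b(1) y(2) scaleC_complex_def)
      qed
      moreover have "y + c *\<^sub>C b \<in> cspan (insert b B)"
        using complex_vector.span_mono[of B "insert b B"] y(1)
        by (intro complex_vector.span_add complex_vector.span_scale)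
           (auto intro: complex_vector.span_base)
      ultimately show ?thesis by blast
    qed
    then show ?thesis using B(1) by (intro exI[of _ "insert b B"]) auto
  qed
qed

text \<open>Infinite dimension of the space enters through the fact that the subspaces in the filter are
nonzero: a vector found along the filter can be normalised.\<close>

lemma frequently_ess_nonzero:
  assumes "\<not> finite_cdim (UNIV :: 'a::complex_normed_vector set)"
  shows "\<exists>\<^sub>F x in ess. x \<noteq> (0::'a)"
  unfolding frequently_def
proof
  assume "\<forall>\<^sub>F x in ess. \<not> x \<noteq> (0::'a)"
  then obtain F where F: "finite F" "\<And>f. f \<in> F \<Longrightarrow> bounded_clinear f"
      "\<And>x::'a. (\<And>f. f \<in> F \<Longrightarrow> f x = (0::complex)) \<Longrightarrow> x = 0"
    unfolding eventually_ess by auto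
  obtain B where "finite B" "\<And>x::'a. \<exists>y\<in>cspan B. \<forall>f\<in>F. f (x - y) = 0"
    using kernel_complement[OF F(1,2)] by blast
  then have "x \<in> cspan B" for x using F(3) by (metis eq_iff_diff_eq_0)
  then have "cspan B = UNIV" by blast
  with \<open>finite B\<close> assms show False unfolding finite_cdim_def by blast
qed

section \<open>Geometric sums of an operator\<close>

text \<open>The operator \<open>\<Sum>i<n. l ^ (n - 1 - i) T ^ i\<close>, the quotient of \<open>l ^ n - T ^ n\<close> by \<open>l - T\<close>. It replaces
the resolvent of \<open>T\<close>, which need not exist, by a polynomial.\<close>

primrec geo :: "('a::complex_vector \<Rightarrow> 'a) \<Rightarrow> complex \<Rightarrow> nat \<Rightarrow> 'a \<Rightarrow> 'a"
  where "geo T l 0 x = 0"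
  | "geo T l (Suc n) x = l *\<^sub>C geo T l n x + (T ^^ n) x"

lemma bounded_clinear_geo: "bounded_clinear T \<Longrightarrow> bounded_clinear (geo T l n)"
proof (induction n)
  case 0
  show ?case using bounded_clinear_zero by simp
next
  case (Suc n)
  then show ?case
    using bounded_clinear_add[OF bounded_clinear_const_scaleC bounded_clinear_funpow] by simp
qed

lemma geo_factor:
  assumes "bounded_clinear T"
  shows "l *\<^sub>C geo T l n x - T (geo T l n x) = (l ^ n) *\<^sub>C x - (T ^^ n) x"
proof (induction n)
  case 0
  then show ?case by (simp add: bounded_clinear_simps[OF assms] scaleC_one)
next
  case (Suc n)
  have "l *\<^sub>C geo T l (Suc n) x - T (geo T l (Suc n) x)
      = l *\<^sub>C (l *\<^sub>C geo T l n x - T (geo T l n x)) + l *\<^sub>C (T ^^ n) x - (T ^^ Suc n) x"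
    by (simp add: bounded_clinear_simps[OF assms] scaleC_add_right
        complex_vector.scale_right_diff_distrib)
  also have "\<dots> = (l ^ Suc n) *\<^sub>C x - (T ^^ Suc n) x"
    unfolding Suc.IH by (simp add: complex_vector.scale_right_diff_distrib scaleC_scaleC)
  finally show ?case .
qed

lemma geo_commute:
  assumes "bounded_clinear T"
  shows "geo T l n (T x) = T (geo T l n x)"
  by (induction n)
     (simp_all add: bounded_clinear_simps[OF assms] flip: funpow_swap1)

lemma geo_commute_funpow:
  assumes "bounded_clinear T"
  shows "geo T l n ((T ^^ m) x) = (T ^^ m) (geo T l n x)"
  by (induction m) (simp_all add: geo_commute[OF assms])

lemma scaleC_geo_eq_sum: "l *\<^sub>C geo T l n x = (\<Sum>i<n. (l ^ (n - i)) *\<^sub>C (T ^^ i) x)"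
proof (induction n)
  case (Suc n)
  have "l *\<^sub>C geo T l (Suc n) x = l *\<^sub>C (\<Sum>i<n. (l ^ (n - i)) *\<^sub>C (T ^^ i) x) + l *\<^sub>C (T ^^ n) x"
    by (simp add: scaleC_add_right Suc.IH)
  also have "l *\<^sub>C (\<Sum>i<n. (l ^ (n - i)) *\<^sub>C (T ^^ i) x) = (\<Sum>i<n. (l ^ (Suc n - i)) *\<^sub>C (T ^^ i) x)"
    by (simp add: complex_vector.scale_sum_right scaleC_scaleC Suc_diff_le)
  finally show ?case by simp
qed simp

lemma sum_powers_root_of_unity:
  assumes "0 < n"
  obtains w :: complex where "cmod w = 1" "w ^ n = 1"
    "\<And>j. 0 < j \<Longrightarrow> j < n \<Longrightarrow> (\<Sum>k<n. (w ^ k) ^ j) = 0"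
proof
  let ?w = "exp (2 * of_real pi * \<i> / of_nat n) :: complex"
  show "cmod ?w = 1" by simp
  have pow: "?w ^ j = exp (2 * of_real pi * \<i> * of_nat j / of_nat n)" for j
    by (simp add: algebra_simps flip: exp_of_nat_mult)
  have eq1: "?w ^ j = 1 \<longleftrightarrow> n dvd j" for j
    unfolding pow by (rule complex_root_unity_eq_1) (use assms in simp)
  show wn: "?w ^ n = 1" using eq1 by simp
  show "(\<Sum>k<n. (?w ^ k) ^ j) = 0" if "0 < j" "j < n" for j
  proof -
    have "?w ^ j \<noteq> 1" using that eq1 by (meson nat_dvd_not_less)
    then have "(\<Sum>k<n. (?w ^ j) ^ k) = ((?w ^ j) ^ n - 1) / (?w ^ j - 1)"
      by (rule geometric_sum)
    also have "(?w ^ j) ^ n = 1" by (metis wn power_mult mult.commute power_one)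
    finally show ?thesis by (simp add: mult.commute flip: power_mult)
  qed
qed

text \<open>Multiplying \<open>geo T l n\<close> by \<open>l\<close> and averaging over the points \<open>l = r w ^ k\<close> on a circle annihilates
every power of \<open>T\<close> except the zeroth. Formally this is
\<open>(1 / n) \<Sum>k<n. l\<^sub>k / (l\<^sub>k - T) = r ^ n / (r ^ n - T ^ n)\<close> with denominators cleared, a discrete form of
Cauchy's formula for the resolvent.\<close>

lemma average_geo:
  assumes w: "w ^ n = 1" "\<And>j. 0 < j \<Longrightarrow> j < n \<Longrightarrow> (\<Sum>k<n. (w ^ k) ^ j) = 0"
    and n: "0 < n"
  shows "(\<Sum>k<n. (r * w ^ k) *\<^sub>C geo T (r * w ^ k) n x) = (of_nat n * r ^ n) *\<^sub>C x"
proof -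
  have coeff: "(\<Sum>k<n. (r * w ^ k) ^ (n - i)) = (if i = 0 then of_nat n * r ^ n else 0)"
    if "i < n" for i
  proof (cases "i = 0")
    case True
    have "(w ^ k) ^ n = 1" for k by (metis w(1) power_mult mult.commute power_one)
    then show ?thesis using True by (simp add: power_mult_distrib)
  next
    case False
    have "(\<Sum>k<n. (r * w ^ k) ^ (n - i)) = r ^ (n - i) * (\<Sum>k<n. (w ^ k) ^ (n - i))"
      by (simp add: power_mult_distrib sum_distrib_left)
    also have "(\<Sum>k<n. (w ^ k) ^ (n - i)) = 0"
      by (rule w(2)) (use that False in auto)
    finally show ?thesis using False by simp
  qed
  have "(\<Sum>k<n. (r * w ^ k) *\<^sub>C geo T (r * w ^ k) n x)
      = (\<Sum>i<n. \<Sum>k<n. ((r * w ^ k) ^ (n - i)) *\<^sub>C (T ^^ i) x)"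
    unfolding scaleC_geo_eq_sum by (rule sum.swap)
  also have "\<dots> = (\<Sum>i<n. (if i = 0 then of_nat n * r ^ n else 0) *\<^sub>C (T ^^ i) x)"
    by (intro sum.cong refl) (simp add: coeff flip: complex_vector.scale_sum_left)
  also have "\<dots> = (\<Sum>i<n. if i = 0 then (of_nat n * r ^ n) *\<^sub>C x else 0)"
    by (intro sum.cong refl) auto
  also have "\<dots> = (of_nat n * r ^ n) *\<^sub>C x" using n by simp
  finally show ?thesis .
qed

text \<open>If the resolvents \<open>1 / (l - T)\<close> were bounded by \<open>1 / c\<close>, then the resolvent identity
\<open>l / (l - T) - m / (m - T) = (m - l) T / ((l - T) (m - T))\<close>, averaged over corresponding
points of the circles of radii \<open>r\<close> and \<open>s\<close>, would bound
\<open>r ^ n / (r ^ n - T ^ n) - s ^ n / (s ^ n - T ^ n)\<close> by \<open>(s - r) N / c\<^sup>2\<close>, uniformly in \<open>n\<close>.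
Multiplying by both denominators leaves only polynomials in \<open>T\<close>; the left-hand side becomes
\<open>(s ^ n - r ^ n) T ^ n\<close>, and a bound for an inverse becomes an application of a lower bound for
\<open>l - T\<close> at one vector. The two families of lower bounds in the hypotheses are exactly those
applications.\<close>

lemma two_radii_estimate:
  fixes T :: "'a::complex_normed_vector \<Rightarrow> 'a" and x :: 'a and n :: nat
  defines "Q t y \<equiv> complex_of_real (t ^ n) *\<^sub>C y - (T ^^ n) y"
  assumes T: "bounded_clinear T" and N: "0 \<le> N" "\<And>y. norm (T y) \<le> N * norm y"
    and n: "0 < n" and c: "0 < c" and rs: "0 \<le> r" "r \<le> s"
    and w: "cmod w = 1" "w ^ n = 1" "\<And>j. 0 < j \<Longrightarrow> j < n \<Longrightarrow> (\<Sum>k<n. (w ^ k) ^ j) = 0"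
    and l_def: "\<And>k. l k = of_real r * w ^ k" and m_def: "\<And>k. m k = of_real s * w ^ k"
    and low1: "\<And>k. k < n \<Longrightarrow> c * norm (geo T (l k) n (geo T (m k) n x))
        \<le> norm (l k *\<^sub>C geo T (l k) n (geo T (m k) n x) - T (geo T (l k) n (geo T (m k) n x)))"
    and low2: "\<And>k. k < n \<Longrightarrow> c * norm (geo T (m k) n (Q r x))
        \<le> norm (m k *\<^sub>C geo T (m k) n (Q r x) - T (geo T (m k) n (Q r x)))"
  shows "c\<^sup>2 * ((s ^ n - r ^ n) * norm ((T ^^ n) x)) \<le> (s - r) * N * norm (Q s (Q r x))"
proof -
  note G = bounded_clinear_geo[OF T]
  note simps = bounded_clinear_simps[OF T] bounded_clinear_simps[OF G]
    bounded_clinear_simps[OF bounded_clinear_funpow[OF T]]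
  have pw: "(w ^ k) ^ n = 1" for k by (metis w(2) power_mult mult.commute power_one)
  have fac_l: "l k *\<^sub>C geo T (l k) n y - T (geo T (l k) n y) = Q r y" for k y
    unfolding geo_factor[OF T] Q_def l_def by (simp add: power_mult_distrib pw)
  have fac_m: "m k *\<^sub>C geo T (m k) n y - T (geo T (m k) n y) = Q s y" for k y
    unfolding geo_factor[OF T] Q_def m_def by (simp add: power_mult_distrib pw)
  have Q_commute: "Q r (geo T (m k) n y) = geo T (m k) n (Q r y)" for k y
    by (simp add: Q_def simps geo_commute_funpow[OF T])
  have avg_l: "(\<Sum>k<n. l k *\<^sub>C geo T (l k) n y) = (of_nat n * of_real (r ^ n)) *\<^sub>C y" for y
    unfolding l_def using average_geo[OF w(2,3) n, of "of_real r"] by simp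
  have avg_m: "(\<Sum>k<n. m k *\<^sub>C geo T (m k) n y) = (of_nat n * of_real (s ^ n)) *\<^sub>C y" for y
    unfolding m_def using average_geo[OF w(2,3) n, of "of_real s"] by simp
  define u where "u k = geo T (l k) n (geo T (m k) n x)" for k
  have u_bound: "c\<^sup>2 * norm (u k) \<le> norm (Q s (Q r x))" if k: "k < n" for k
  proof -
    have "c\<^sup>2 * norm (u k) = c * (c * norm (u k))" by (simp add: power2_eq_square)
    also have "\<dots> \<le> c * norm (Q r (geo T (m k) n x))"
      using low1[OF k] c unfolding u_def fac_l by simp
    also have "\<dots> \<le> norm (Q s (Q r x))"
      using low2[OF k] unfolding fac_m Q_commute .
    finally show ?thesis .
  qed
  have eq_l: "l k *\<^sub>C geo T (l k) n (Q s x) = (l k * m k) *\<^sub>C u k - l k *\<^sub>C T (u k)" for k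
    unfolding fac_m[of k x, symmetric] u_def
    by (simp add: simps geo_commute[OF T] complex_vector.scale_right_diff_distrib scaleC_scaleC)
  have eq_m: "Q r (m k *\<^sub>C geo T (m k) n x) = (l k * m k) *\<^sub>C u k - m k *\<^sub>C T (u k)" for k
  proof -
    have "Q r (m k *\<^sub>C geo T (m k) n x) = m k *\<^sub>C Q r (geo T (m k) n x)"
      by (simp add: Q_def simps complex_vector.scale_right_diff_distrib scaleC_scaleC mult.commute)
    also have "\<dots> = m k *\<^sub>C (l k *\<^sub>C u k - T (u k))"
      unfolding u_def fac_l ..
    finally show ?thesis
      by (simp add: complex_vector.scale_right_diff_distrib scaleC_scaleC mult.commute)
  qed
  have Q_lin: "bounded_clinear (Q r)"
    unfolding Q_def
    by (intro bounded_clinear_sub bounded_clinear_const_scaleC bounded_clinear_ident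
        bounded_clinear_funpow T)
  have "(of_nat n * of_real (s ^ n - r ^ n)) *\<^sub>C (T ^^ n) x
      = (of_nat n * of_real (r ^ n)) *\<^sub>C Q s x - Q r ((of_nat n * of_real (s ^ n)) *\<^sub>C x)"
    by (simp add: Q_def simps complex_vector.scale_right_diff_distrib scaleC_scaleC
        complex_vector.scale_left_diff_distrib algebra_simps)
  also have "\<dots> = (\<Sum>k<n. l k *\<^sub>C geo T (l k) n (Q s x) - Q r (m k *\<^sub>C geo T (m k) n x))"
    unfolding avg_l[symmetric] avg_m[symmetric] sum_subtractf
    by (simp add: linear_sum[OF bounded_clinear_linear[OF Q_lin]])
  also have "\<dots> = (\<Sum>k<n. (m k - l k) *\<^sub>C T (u k))"
    unfolding eq_l eq_m by (intro sum.cong refl) (simp add: complex_vector.scale_left_diff_distrib)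
  finally have key: "(of_nat n * of_real (s ^ n - r ^ n)) *\<^sub>C (T ^^ n) x
      = (\<Sum>k<n. (m k - l k) *\<^sub>C T (u k))" .
  have summand: "c\<^sup>2 * norm ((m k - l k) *\<^sub>C T (u k)) \<le> (s - r) * N * norm (Q s (Q r x))"
    if k: "k < n" for k
  proof -
    have "m k - l k = of_real (s - r) * w ^ k" by (simp add: m_def l_def algebra_simps)
    then have ml: "cmod (m k - l k) = s - r" using rs w(1) by (simp add: norm_mult norm_power flip: of_real_diff)
    have "c\<^sup>2 * norm ((m k - l k) *\<^sub>C T (u k)) = (s - r) * (c\<^sup>2 * norm (T (u k)))"
      by (simp add: norm_scaleC ml)
    also have "\<dots> \<le> (s - r) * (c\<^sup>2 * (N * norm (u k)))"
      using rs N(2)[of "u k"] by (intro mult_left_mono) auto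
    also have "\<dots> = (s - r) * N * (c\<^sup>2 * norm (u k))" by simp
    also have "\<dots> \<le> (s - r) * N * norm (Q s (Q r x))"
      using u_bound[OF k] rs N(1) by (intro mult_left_mono) auto
    finally show ?thesis .
  qed
  have "real n * (c\<^sup>2 * ((s ^ n - r ^ n) * norm ((T ^^ n) x)))
      = c\<^sup>2 * norm ((of_nat n * of_real (s ^ n - r ^ n)) *\<^sub>C (T ^^ n) x)"
    using power_mono[OF rs(2,1), of n]
    by (simp add: norm_scaleC norm_mult flip: of_real_diff of_real_power)
  also have "\<dots> \<le> c\<^sup>2 * (\<Sum>k<n. norm ((m k - l k) *\<^sub>C T (u k)))"
    unfolding key by (intro mult_left_mono norm_sum) simp
  also have "\<dots> = (\<Sum>k<n. c\<^sup>2 * norm ((m k - l k) *\<^sub>C T (u k)))"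
    by (rule sum_distrib_left)
  also have "\<dots> \<le> (\<Sum>k<n. (s - r) * N * norm (Q s (Q r x)))"
    by (intro sum_mono summand) simp
  also have "\<dots> = real n * ((s - r) * N * norm (Q s (Q r x)))" by simp
  finally show ?thesis using n by simp
qed

section \<open>An essential approximate eigenvalue\<close>

text \<open>The vectors at which the lower bounds are applied are images of \<open>x\<close> under finitely many polynomials
in \<open>T\<close>, so an essential lower bound on a disc supplies all of them at once.\<close>

lemma eventually_ess_two_radii:
  fixes T :: "'a::complex_normed_vector \<Rightarrow> 'a"
  assumes T: "bounded_clinear T" and N: "0 \<le> N" "\<And>y. norm (T y) \<le> N * norm y"
    and low: "\<forall>\<^sub>F x in ess. \<forall>l\<in>cball 0 R. c * norm x \<le> norm (l *\<^sub>C x - T x)"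
    and c: "0 < c" and n: "0 < n" and rs: "0 \<le> r" "r \<le> s" "s \<le> R"
    and C: "\<forall>\<^sub>F x in ess. norm ((T ^^ n) x) \<le> C * norm x" "0 \<le> C"
  shows "\<forall>\<^sub>F x in ess. c\<^sup>2 * ((s ^ n - r ^ n) * norm ((T ^^ n) x))
      \<le> (s - r) * N * ((s ^ n + C) * ((r ^ n + C) * norm x))"
proof -
  define Q where "Q t y = complex_of_real (t ^ n) *\<^sub>C y - (T ^^ n) y" for t y
  obtain w :: complex where w: "cmod w = 1" "w ^ n = 1"
      "\<And>j. 0 < j \<Longrightarrow> j < n \<Longrightarrow> (\<Sum>k<n. (w ^ k) ^ j) = 0"
    using sum_powers_root_of_unity[OF n] by blast
  define l where "l k = of_real r * w ^ k" for k
  define m where "m k = of_real s * w ^ k" for k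
  have lm: "l k \<in> cball 0 R" "m k \<in> cball 0 R" for k
    using rs w(1) by (auto simp: l_def m_def norm_mult norm_power)
  note G = bounded_clinear_geo[OF T]
  have Q: "bounded_clinear (Q t)" for t
    unfolding Q_def
    by (intro bounded_clinear_sub bounded_clinear_const_scaleC bounded_clinear_ident
        bounded_clinear_funpow T)
  have low_at: "\<forall>\<^sub>F x in ess. c * norm (A x) \<le> norm (z *\<^sub>C A x - T (A x))"
    if "z \<in> cball 0 R" "bounded_clinear A" for z and A :: "'a \<Rightarrow> 'a"
    using eventually_ess_compose[OF that(2) low] by eventually_elim (use that(1) in blast)
  have ev1: "\<forall>\<^sub>F x in ess. \<forall>k\<in>{..<n}. c * norm (geo T (l k) n (geo T (m k) n x))
      \<le> norm (l k *\<^sub>C geo T (l k) n (geo T (m k) n x) - T (geo T (l k) n (geo T (m k) n x)))"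
    by (intro eventually_ball_finite ballI finite_lessThan low_at lm bounded_clinear_compose[OF G G])
  have ev2: "\<forall>\<^sub>F x in ess. \<forall>k\<in>{..<n}. c * norm (geo T (m k) n (Q r x))
      \<le> norm (m k *\<^sub>C geo T (m k) n (Q r x) - T (geo T (m k) n (Q r x)))"
    by (intro eventually_ball_finite ballI finite_lessThan low_at lm bounded_clinear_compose[OF G Q])
  have Q_bound: "\<forall>\<^sub>F x in ess. norm (Q t x) \<le> (t ^ n + C) * norm x" if t: "0 \<le> t" for t
    using C(1)
  proof eventually_elim
    fix x assume x: "norm ((T ^^ n) x) \<le> C * norm x"
    have "norm (Q t x) \<le> norm (complex_of_real (t ^ n) *\<^sub>C x) + norm ((T ^^ n) x)"
      unfolding Q_def by (rule norm_triangle_ineq4)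
    then show "norm (Q t x) \<le> (t ^ n + C) * norm x"
      using x t by (simp add: norm_scaleC norm_power algebra_simps)
  qed
  have s: "0 \<le> s" using rs by simp
  show ?thesis
    using ev1 ev2 Q_bound[OF rs(1)] eventually_ess_compose[OF Q Q_bound[OF s], of r]
  proof eventually_elim
    fix x
    assume 1: "\<forall>k\<in>{..<n}. c * norm (geo T (l k) n (geo T (m k) n x))
        \<le> norm (l k *\<^sub>C geo T (l k) n (geo T (m k) n x) - T (geo T (l k) n (geo T (m k) n x)))"
      and 2: "\<forall>k\<in>{..<n}. c * norm (geo T (m k) n (Q r x))
        \<le> norm (m k *\<^sub>C geo T (m k) n (Q r x) - T (geo T (m k) n (Q r x)))"
      and 3: "norm (Q r x) \<le> (r ^ n + C) * norm x"
      and 4: "norm (Q s (Q r x)) \<le> (s ^ n + C) * norm (Q r x)"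
    have "c\<^sup>2 * ((s ^ n - r ^ n) * norm ((T ^^ n) x)) \<le> (s - r) * N * norm (Q s (Q r x))"
      unfolding Q_def
      by (rule two_radii_estimate[OF T N n c rs(1,2) w l_def m_def])
         (use 1 2 in \<open>simp_all only: lessThan_iff Q_def\<close>)
    also have "\<dots> \<le> (s - r) * N * ((s ^ n + C) * ((r ^ n + C) * norm x))"
    proof (rule mult_left_mono)
      have "(s ^ n + C) * norm (Q r x) \<le> (s ^ n + C) * ((r ^ n + C) * norm x)"
        using 3 s C(2) by (intro mult_left_mono) auto
      with 4 show "norm (Q s (Q r x)) \<le> (s ^ n + C) * ((r ^ n + C) * norm x)" by linarith
    qed (use rs N in simp)
    finally show "c\<^sup>2 * ((s ^ n - r ^ n) * norm ((T ^^ n) x))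
        \<le> (s - r) * N * ((s ^ n + C) * ((r ^ n + C) * norm x))" .
  qed
qed

text \<open>A lower bound \<open>e\<close> at \<open>l\<close> persists as \<open>e / 2\<close> on the ball of radius \<open>e / 2\<close> about \<open>l\<close>, so by compactness
of the disc one constant and one finite-codimensional subspace serve the whole disc.\<close>

lemma uniform_lower_bound:
  fixes T :: "'a::complex_normed_vector \<Rightarrow> 'a"
  assumes "\<And>l. \<exists>e>0. \<forall>\<^sub>F x in ess. e * norm x \<le> norm (l *\<^sub>C x - T x)" and R: "0 \<le> R"
  obtains c where "0 < c" "\<forall>\<^sub>F x in ess. \<forall>l\<in>cball 0 R. c * norm x \<le> norm (l *\<^sub>C x - T x)"
proof -
  obtain e where e: "\<And>l. 0 < e l" "\<And>l. \<forall>\<^sub>F x in ess. e l * norm x \<le> norm (l *\<^sub>C x - T x)"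
    using assms(1) by metis
  have "cball (0::complex) R \<subseteq> (\<Union>l\<in>cball 0 R. ball l (e l / 2))"
    using e(1) by fastforce
  then obtain D where D: "D \<subseteq> cball 0 R" "finite D" "cball 0 R \<subseteq> (\<Union>l\<in>D. ball l (e l / 2))"
    using compactE_image[OF compact_cball, of "cball 0 R" "\<lambda>l. ball l (e l / 2)" 0 R] by auto
  have "D \<noteq> {}" using D(3) R by (metis UN_empty cball_eq_empty not_le subset_empty)
  define c where "c = Min ((\<lambda>l. e l / 2) ` D)"
  have c_le: "c \<le> e l / 2" if "l \<in> D" for l
    unfolding c_def using that D(2) by (intro Min_le) auto
  show thesis
  proof
    show "0 < c" unfolding c_def using D(2) \<open>D \<noteq> {}\<close> e(1) by simp
    have "\<forall>\<^sub>F x in ess. \<forall>l\<in>D. e l * norm x \<le> norm (l *\<^sub>C x - T x)"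
      using D(2) e(2) by (simp add: eventually_ball_finite)
    then show "\<forall>\<^sub>F x in ess. \<forall>l\<in>cball 0 R. c * norm x \<le> norm (l *\<^sub>C x - T x)"
    proof eventually_elim
      fix x assume x: "\<forall>l\<in>D. e l * norm x \<le> norm (l *\<^sub>C x - T x)"
      show "\<forall>l\<in>cball 0 R. c * norm x \<le> norm (l *\<^sub>C x - T x)"
      proof
        fix m :: complex assume "m \<in> cball 0 R"
        then obtain l where l: "l \<in> D" "m \<in> ball l (e l / 2)" using D(3) by blast
        have "norm (l *\<^sub>C x - T x) \<le> norm (m *\<^sub>C x - T x) + norm ((l - m) *\<^sub>C x)"
          using norm_triangle_ineq[of "m *\<^sub>C x - T x" "(l - m) *\<^sub>C x"]
          by (simp add: complex_vector.scale_left_diff_distrib)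
        moreover have "norm ((l - m) *\<^sub>C x) \<le> e l / 2 * norm x"
          unfolding norm_scaleC using l(2) by (intro mult_right_mono) (auto simp: dist_norm)
        moreover have "c * norm x \<le> e l / 2 * norm x"
          using c_le[OF l(1)] by (rule mult_right_mono) simp
        ultimately show "c * norm x \<le> norm (m *\<^sub>C x - T x)" using bspec[OF x l(1)] by linarith
      qed
    qed
  qed
qed

lemma eventually_ess_funpow_lower:
  fixes T :: "'a::complex_normed_vector \<Rightarrow> 'a"
  assumes T: "bounded_clinear T" and c: "0 \<le> c"
    and low: "\<forall>\<^sub>F x in ess. c * norm x \<le> norm (T x)"
  shows "\<forall>\<^sub>F x in ess. c ^ n * norm x \<le> norm ((T ^^ n) x)"
proof (induction n)
  case (Suc n)
  show ?case
    using Suc.IH eventually_ess_compose[OF bounded_clinear_funpow[OF T] low, of n]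
  proof eventually_elim
    case (elim x)
    have "c ^ Suc n * norm x \<le> c * norm ((T ^^ n) x)"
      using mult_left_mono[OF elim(1) c] by simp
    then show ?case using elim(2) by simp
  qed
qed simp

lemma eventually_ess_funpow_upper:
  fixes T :: "'a::complex_normed_vector \<Rightarrow> 'a"
  assumes T: "bounded_clinear T" and q: "0 \<le> q"
    and up: "\<forall>\<^sub>F x in ess. norm ((T ^^ m) x) \<le> q ^ m * norm x"
  shows "\<forall>\<^sub>F x in ess. norm ((T ^^ (m * k)) x) \<le> q ^ (m * k) * norm x"
proof (induction k)
  case (Suc k)
  show ?case
    using Suc.IH eventually_ess_compose[OF bounded_clinear_funpow[OF T] up, of "m * k"]
  proof eventually_elim
    case (elim x)
    have "norm ((T ^^ (m * Suc k)) x) \<le> q ^ m * norm ((T ^^ (m * k)) x)"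
      using elim(2) by (simp add: funpow_add)
    also have "\<dots> \<le> q ^ m * (q ^ (m * k) * norm x)"
      using elim(1) q by (intro mult_left_mono) auto
    finally show ?case by (simp add: power_add mult.assoc)
  qed
qed simp

text \<open>Suppose that every \<open>l - T\<close> is essentially bounded below, and let \<open>c\<close> be a common lower bound on a
large disc. Let \<open>\<rho>\<close> be the essential spectral radius, the infimum of the \<open>q\<close> for which some power
satisfies \<open>norm (T ^ n x) \<le> q ^ n * norm x\<close> essentially. It is at least \<open>c\<close>, by the lower bound
at \<open>l = 0\<close>. For \<open>r < \<rho> < s\<close> the essential norm \<open>a\<close> of \<open>T ^ n\<close> lies between
\<open>r ^ n\<close> and \<open>s ^ n\<close> for arbitrarily large \<open>n\<close>, so the two-radii estimate compares a left-hand side of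
order \<open>s ^ n * a\<close> with a right-hand side of order \<open>(s - r) * s ^ n * a\<close>, with constants that do not
depend on \<open>n\<close>, \<open>r\<close> or \<open>s\<close>. This is absurd once \<open>s - r\<close> is small.\<close>

lemma essential_approximate_eigenvalue:
  fixes T :: "'a::complex_normed_vector \<Rightarrow> 'a"
  assumes inf: "\<not> finite_cdim (UNIV :: 'a set)" and T: "bounded_clinear T"
  obtains l where "\<And>e. 0 < e \<Longrightarrow> \<exists>\<^sub>F x in ess. norm (l *\<^sub>C x - T x) < e * norm x"
proof (rule ccontr)
  assume "\<not> thesis"
  then have neg: "\<exists>e>0. \<forall>\<^sub>F x in ess. e * norm x \<le> norm (l *\<^sub>C x - T x)" for l
  proof -
    have "\<not> (\<forall>e>0. \<exists>\<^sub>F x in ess. norm (l *\<^sub>C x - T x) < e * norm x)"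
      using that[of l] \<open>\<not> thesis\<close> by blast
    then show ?thesis by (simp add: not_frequently not_less)
  qed
  obtain N where N: "0 < N" "\<And>y. norm (T y) \<le> N * norm y"
    using bounded_linear.pos_bounded[OF bounded_clinear_bounded_linear[OF T]]
    by (metis mult.commute)
  obtain c where c: "0 < c"
    and low: "\<forall>\<^sub>F x in ess. \<forall>l\<in>cball 0 (N + 1). c * norm x \<le> norm (l *\<^sub>C x - T x)"
    using uniform_lower_bound[OF neg, of "N + 1"] N(1) by auto
  have low0: "\<forall>\<^sub>F x in ess. c * norm x \<le> norm (T x)"
    using low
  proof eventually_elim
    case (elim x)
    have "(0::complex) \<in> cball 0 (N + 1)" using N(1) by simp
    from bspec[OF elim this] show ?case by simp
  qed
  define bd where "bd C n \<longleftrightarrow> 0 \<le> C \<and> (\<forall>\<^sub>F x in ess. norm ((T ^^ n) x) \<le> C * norm x)" for C n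
  have bd_mono: "bd D n" if "bd C n" "C \<le> D" for C D n
  proof -
    have "\<forall>\<^sub>F x in ess. norm ((T ^^ n) x) \<le> C * norm x" using that(1) unfolding bd_def by blast
    then have "\<forall>\<^sub>F x in ess. norm ((T ^^ n) x) \<le> D * norm x"
    proof eventually_elim
      case (elim x)
      then show ?case using mult_right_mono[OF that(2) norm_ge_zero[of x]] by linarith
    qed
    then show ?thesis using that unfolding bd_def by simp
  qed
  define A where "A = {q. 0 \<le> q \<and> (\<exists>n>0. bd (q ^ n) n)}"
  have "bd (N ^ 1) 1" using N by (simp add: bd_def)
  then have "N \<in> A" using N(1) unfolding A_def by (intro CollectI conjI exI[of _ 1]) simp_all
  have c_le: "c \<le> q" if q: "q \<in> A" for q
  proof -
    obtain n where n: "0 < n" "bd (q ^ n) n" "0 \<le> q" using q unfolding A_def by blast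
    from n(2) have "\<forall>\<^sub>F x in ess. norm ((T ^^ n) x) \<le> q ^ n * norm x"
      unfolding bd_def by blast
    then have "\<forall>\<^sub>F x::'a in ess. c ^ n * norm x \<le> q ^ n * norm x"
      using eventually_ess_funpow_lower[OF T less_imp_le[OF c] low0, of n]
      by eventually_elim linarith
    then have "\<exists>\<^sub>F x in ess. (x::'a) \<noteq> 0 \<and> c ^ n * norm x \<le> q ^ n * norm x"
      by (rule frequently_eventually_frequently[OF frequently_ess_nonzero[OF inf]])
    from frequently_ex[OF this] obtain x :: 'a where "x \<noteq> 0" "c ^ n * norm x \<le> q ^ n * norm x"
      by blast
    then have "c ^ n \<le> q ^ n" by simp
    then show ?thesis using n c by (simp add: power_mono_iff)
  qed
  define \<rho> where "\<rho> = Inf A"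
  have bdd: "bdd_below A" using c_le by (rule bdd_belowI)
  have \<rho>: "c \<le> \<rho>" "\<rho> \<le> N"
    unfolding \<rho>_def using \<open>N \<in> A\<close> c_le bdd by (auto intro: cInf_greatest cInf_lower)
  \<comment> \<open>\<open>c / 2\<close> keeps the inner radius positive, \<open>1\<close> keeps the outer one in the disc, and the last bound
    is what the final comparison consumes.\<close>
  define d where "d = min (min (c / 2) 1) (c\<^sup>2 / (48 * N))"
  have d: "0 < d" "d \<le> c / 2" "d \<le> 1" "48 * d * N \<le> c\<^sup>2"
  proof -
    have "d \<le> c\<^sup>2 / (48 * N)" by (simp add: d_def)
    then show "48 * d * N \<le> c\<^sup>2" using N(1) by (simp add: field_simps)
  qed (use c N(1) in \<open>auto simp: d_def\<close>)
  define r where "r = \<rho> - d"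
  define s where "s = \<rho> + d"
  have rs: "0 < r" "r < s" "s \<le> N + 1" using \<rho> d c by (auto simp: r_def s_def)
  obtain q where q: "q \<in> A" "q < s"
    using cInf_lessD[of A s] \<open>N \<in> A\<close> d(1) unfolding \<rho>_def s_def by auto
  obtain m where m: "0 < m" "bd (q ^ m) m" "0 \<le> q" using q(1) unfolding A_def by blast
  obtain k where k: "(r / s) ^ k < 1 / 2"
    using real_arch_pow_inv[of "1/2" "r / s"] rs by auto
  \<comment> \<open>The exponents with an upper bound are closed under multiples, so \<open>n\<close> can be taken large enough
    for \<open>r ^ n\<close> to be at most half of \<open>s ^ n\<close>.\<close>
  define n where "n = m * Suc k"
  have n: "0 < n" "k \<le> n" using m(1) mult_le_mono[of 1 m k "Suc k"] unfolding n_def by auto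
  have half: "r ^ n \<le> s ^ n / 2"
  proof -
    have "(r / s) ^ n \<le> (r / s) ^ k" using rs n(2) by (intro power_decreasing) auto
    then have "(r / s) ^ n \<le> 1 / 2" using k by linarith
    then show ?thesis using rs by (simp add: power_divide divide_le_eq)
  qed
  have "bd (q ^ n) n"
    unfolding n_def bd_def
    using eventually_ess_funpow_upper[OF T m(3), of m "Suc k"] m(2,3) unfolding bd_def by simp
  then have bd_s: "bd (s ^ n) n"
    by (rule bd_mono) (use q(2) m(3) in \<open>simp add: power_mono\<close>)
  have not_bd_r: "\<not> bd (r ^ n) n"
  proof
    assume "bd (r ^ n) n"
    then have "r \<in> A" using n(1) rs(1) unfolding A_def by auto
    then have "\<rho> \<le> r" unfolding \<rho>_def using bdd by (rule cInf_lower)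
    then show False using d(1) by (simp add: r_def)
  qed
  \<comment> \<open>\<open>a\<close> is the essential norm of \<open>T ^ n\<close>. The constant \<open>C\<close> chosen below is an essential bound,
    while \<open>C / 2\<close> is not.\<close>
  define a where "a = Inf {C. bd C n}"
  have bdd': "bdd_below {C. bd C n}" by (rule bdd_belowI[of _ 0]) (auto simp: bd_def)
  have r_le: "r ^ n \<le> C" if "bd C n" for C
    using that not_bd_r bd_mono by (meson linear)
  have a: "r ^ n \<le> a" "a \<le> s ^ n"
    unfolding a_def using bd_s r_le bdd' by (auto intro: cInf_greatest cInf_lower)
  have "0 < r ^ n" using rs(1) by simp
  then have "a < 2 * a" using a(1) by linarith
  then obtain C where C: "bd C n" "C < 2 * a"
    using cInf_lessD[of "{C. bd C n}" "2 * a"] bd_s unfolding a_def by auto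
  have "0 \<le> C" using C(1) by (simp add: bd_def)
  have "\<not> bd (C / 2) n"
  proof
    assume "bd (C / 2) n"
    then have "a \<le> C / 2" unfolding a_def by (intro cInf_lower[OF _ bdd'] CollectI)
    then show False using C(2) by simp
  qed
  then have "\<exists>\<^sub>F x in ess. C / 2 * norm x < norm ((T ^^ n) x)"
    using \<open>0 \<le> C\<close> unfolding bd_def frequently_def not_less by simp
  moreover have "\<forall>\<^sub>F x in ess. c\<^sup>2 * ((s ^ n - r ^ n) * norm ((T ^^ n) x))
      \<le> (s - r) * N * ((s ^ n + C) * ((r ^ n + C) * norm x))"
    using C(1) rs N(1) unfolding bd_def
    by (intro eventually_ess_two_radii[OF T _ N(2) low c n(1)]) auto
  ultimately have "\<exists>\<^sub>F x in ess. C / 2 * norm x < norm ((T ^^ n) x) \<and>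
      c\<^sup>2 * ((s ^ n - r ^ n) * norm ((T ^^ n) x))
      \<le> (s - r) * N * ((s ^ n + C) * ((r ^ n + C) * norm x))"
    by (rule frequently_eventually_frequently)
  from frequently_ex[OF this] obtain x :: 'a where x: "C / 2 * norm x < norm ((T ^^ n) x)"
      "c\<^sup>2 * ((s ^ n - r ^ n) * norm ((T ^^ n) x))
      \<le> (s - r) * N * ((s ^ n + C) * ((r ^ n + C) * norm x))"
    by blast
  have C_pos: "0 < C" using r_le[OF C(1)] \<open>0 < r ^ n\<close> by linarith
  have s_pos: "0 < s ^ n" using rs by simp
  have "c\<^sup>2 * (s ^ n / 2 * (C / 2 * norm x)) < c\<^sup>2 * ((s ^ n - r ^ n) * norm ((T ^^ n) x))"
  proof (rule mult_strict_left_mono)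
    have "s ^ n / 2 * (C / 2 * norm x) < s ^ n / 2 * norm ((T ^^ n) x)"
      using x(1) s_pos by (intro mult_strict_left_mono) auto
    also have "\<dots> \<le> (s ^ n - r ^ n) * norm ((T ^^ n) x)"
      using half by (intro mult_right_mono) auto
    finally show "s ^ n / 2 * (C / 2 * norm x) < (s ^ n - r ^ n) * norm ((T ^^ n) x)" .
  qed (use c in simp)
  also note x(2)
  also have "(s - r) * N * ((s ^ n + C) * ((r ^ n + C) * norm x))
      \<le> 2 * d * N * (3 * s ^ n * (2 * C * norm x))"
  proof -
    have "(r ^ n + C) * norm x \<le> 2 * C * norm x"
      using r_le[OF C(1)] by (intro mult_right_mono) auto
    moreover have "s ^ n + C \<le> 3 * s ^ n" using C(2) a(2) by linarith
    ultimately have "(s ^ n + C) * ((r ^ n + C) * norm x) \<le> 3 * s ^ n * (2 * C * norm x)"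
      using C_pos s_pos \<open>0 < r ^ n\<close> r_le[OF C(1)] by (intro mult_mono) simp_all
    then have "2 * d * N * ((s ^ n + C) * ((r ^ n + C) * norm x))
        \<le> 2 * d * N * (3 * s ^ n * (2 * C * norm x))"
      using d(1) N(1) by (intro mult_left_mono) simp_all
    moreover have "s - r = 2 * d" by (simp add: r_def s_def)
    ultimately show ?thesis by simp
  qed
  also have "\<dots> = 48 * d * N * (s ^ n / 2 * (C / 2 * norm x))" by (simp add: field_simps)
  also have "\<dots> \<le> c\<^sup>2 * (s ^ n / 2 * (C / 2 * norm x))"
    using d(4) s_pos C_pos by (intro mult_right_mono) auto
  finally show False by simp
qed

section \<open>Biorthogonal sequences and perturbation\<close>

lemma csubspace_kernel: "bounded_clinear f \<Longrightarrow> csubspace {x. f x = 0}"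
  unfolding complex_vector.subspace_def by (simp add: bounded_clinear_simps)

lemma closed_kernel: "bounded_clinear f \<Longrightarrow> closed {x. f x = 0}"
  by (intro closed_Collect_eq continuous_on_const linear_continuous_on bounded_clinear_bounded_linear)

text \<open>Both halves of the halfspace property come from this: applied to vectors inside \<open>Y\<close> it shows infinite
dimension, applied to functionals that vanish on \<open>Y\<close> it shows infinite codimension.\<close>

lemma biorthogonal_not_finitely_spanned:
  fixes f :: "nat \<Rightarrow> 'a::complex_normed_vector \<Rightarrow> complex"
  assumes f: "\<And>n. bounded_clinear (f n)"
    and fb: "\<And>m n. f m (b n) = (if m = n then 1 else 0)" and B: "finite B"
  shows "\<not> range b \<subseteq> cspan B"
proof
  assume sub: "range b \<subseteq> cspan B"
  have "inj b" using fb by (metis injI zero_neq_one)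
  have "\<not> cdependent (range b)"
  proof
    assume "cdependent (range b)"
    then obtain n where n: "b n \<in> cspan (range b - {b n})"
      unfolding complex_vector.dependent_def by auto
    have "cspan (range b - {b n}) \<subseteq> {x. f n x = 0}"
      by (rule complex_vector.span_minimal[OF _ csubspace_kernel[OF f]]) (auto simp: fb)
    then show False using n fb[of n n] by auto
  qed
  from complex_vector.independent_span_bound[OF B this sub] have "finite (range b)" by blast
  then show False using \<open>inj b\<close> range_inj_infinite by blast
qed

text \<open>Extending a biorthogonal system. \<open>P\<close> is the projection that removes the vectors chosen so far; it
is the identity on a subspace of finite codimension, and there the next vector \<open>x\<close> is found. The
composition of a norming functional of \<open>x\<close> with \<open>P\<close> vanishes on all earlier vectors and costs only a
factor \<open>norm P\<close>.\<close>

lemma projection_step: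
  fixes P S :: "'a::complex_normed_vector \<Rightarrow> 'a"
  assumes P: "bounded_clinear P" "\<And>y. P (P y) = P y" "\<And>y. norm (P y) \<le> M * norm y"
      "\<forall>\<^sub>F y in ess. P y = y"
    and S: "bounded_clinear S" "\<exists>\<^sub>F x in ess. norm (S x) < e * norm x"
  obtains x f where "norm x = 1" "P x = x" "norm (S x) < e" "bounded_clinear f" "f x = (1::complex)"
    "\<And>y. cmod (f y) \<le> 2 * M * norm y" "\<And>y. f (P y) = f y"
proof -
  have "\<exists>\<^sub>F x in ess. norm (S x) < e * norm x \<and> P x = x"
    by (rule frequently_eventually_frequently[OF S(2) P(4)])
  from frequently_ex[OF this] obtain u where u: "norm (S u) < e * norm u" "P u = u" by blast
  have u0: "u \<noteq> 0" using u(1) by (auto simp: bounded_clinear_simps[OF S(1)])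
  define x where "x = complex_of_real (inverse (norm u)) *\<^sub>C u"
  have x: "norm x = 1" unfolding x_def norm_scaleC norm_of_real using u0 by simp
  obtain g where g: "bounded_clinear g" "g x = (1::complex)" "\<And>y. cmod (g y) \<le> 2 * norm y"
    using norming_functional[OF x] by blast
  have Px: "P x = x" by (simp add: x_def bounded_clinear_simps[OF P(1)] u(2))
  show thesis
  proof (rule that[OF x Px])
    have "norm u * norm (S x) = norm (S u)"
      unfolding x_def bounded_clinear_scaleC[OF S(1)] norm_scaleC norm_of_real using u0 by simp
    then have "norm u * norm (S x) < norm u * e" using u(1) by (simp add: mult.commute)
    then show "norm (S x) < e" using u0 by (simp add: mult_less_cancel_left_pos)
    show "bounded_clinear (\<lambda>y. g (P y))" by (rule bounded_clinear_compose[OF g(1) P(1)])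
    show "g (P x) = 1" using Px g(2) by simp
    show "cmod (g (P y)) \<le> 2 * M * norm y" for y
      using g(3)[of "P y"] P(3)[of y] by linarith
    show "g (P (P y)) = g (P y)" for y by (simp add: P(2))
  qed
qed

text \<open>The state of the recursion is the projection \<open>P n\<close> together with the current pair, and
\<open>P (Suc n) = P n - f n \<otimes> x n\<close>. Hence the norm of \<open>P n\<close> grows at most like \<open>3 ^ n\<close>. This growth is fixed
in advance, so the smallness \<open>e n\<close> can be prescribed to beat it, and no basic sequence has to be
constructed. For \<open>n < m\<close>, the functional \<open>f n\<close> annihilates the range of
\<open>P m\<close>, which contains \<open>x m\<close>, and \<open>f m\<close> factors through \<open>P m\<close>, whose kernel contains \<open>x n\<close>.\<close>

lemma biorthogonal_small_sequence:
  fixes S :: "'a::complex_normed_vector \<Rightarrow> 'a"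
  assumes S: "bounded_clinear S" "\<And>e. 0 < e \<Longrightarrow> \<exists>\<^sub>F x in ess. norm (S x) < e * norm x"
    and e: "\<And>n. 0 < e n"
  obtains x f where "\<And>n. norm (S (x n)) < e n" "\<And>n. bounded_clinear (f n)"
    "\<And>n y. cmod (f n y) \<le> 2 * 3 ^ n * norm y"
    "\<And>m n. f m (x n) = (if m = n then 1 else 0)"
proof -
  define proj where "proj n P \<longleftrightarrow> bounded_clinear P \<and> (\<forall>y. P (P y) = P y) \<and>
      (\<forall>y. norm (P y) \<le> 3 ^ n * norm y) \<and> (\<forall>\<^sub>F y in ess. P y = y)" for n and P :: "'a \<Rightarrow> 'a"
  define good where "good n = (\<lambda>(P, x, f). proj n P \<and> norm x = 1 \<and> P x = x \<and> norm (S x) < e n \<and>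
      bounded_clinear f \<and> f x = (1::complex) \<and> (\<forall>y. cmod (f y) \<le> 2 * 3 ^ n * norm y) \<and>
      (\<forall>y. f (P y) = f y))" for n
  define step where "step = (\<lambda>(P, x, f :: 'a \<Rightarrow> complex) (P' :: 'a \<Rightarrow> 'a, x' :: 'a, f' :: 'a \<Rightarrow> complex).
      \<forall>y. P' y = P y - f y *\<^sub>C x)"
  \<comment> \<open>The invariant splits in two: a projection can always be completed by a pair, and a complete
    state determines the next projection.\<close>
  have extend: "\<exists>x f. good n (P, x, f)" if P: "proj n P" for n P
  proof -
    have P': "bounded_clinear P" "\<And>y. P (P y) = P y" "\<And>y. norm (P y) \<le> 3 ^ n * norm y"
        "\<forall>\<^sub>F y in ess. P y = y"
      using P unfolding proj_def by blast+
    obtain x f where "norm x = 1" "P x = x" "norm (S x) < e n" "bounded_clinear f"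
        "f x = (1::complex)" "\<And>y. cmod (f y) \<le> 2 * 3 ^ n * norm y" "\<And>y. f (P y) = f y"
      by (rule projection_step[OF P' S(1) S(2)[OF e[of n]]]) (rule that)
    with P have "good n (P, x, f)" unfolding good_def by simp
    then show ?thesis by blast
  qed
  have shrink: "proj (Suc n) (\<lambda>y. P y - f y *\<^sub>C x)" if good: "good n (P, x, f)" for n P x f
  proof -
    have P: "bounded_clinear P" "\<And>y. P (P y) = P y" "\<And>y. norm (P y) \<le> 3 ^ n * norm y"
        "\<forall>\<^sub>F y in ess. P y = y"
      and x: "norm x = 1" "P x = x"
      and f: "bounded_clinear f" "f x = 1" "\<And>y. cmod (f y) \<le> 2 * 3 ^ n * norm y" "\<And>y. f (P y) = f y"
      using good unfolding good_def proj_def by simp_all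
    show ?thesis unfolding proj_def
    proof (intro conjI allI)
      show "bounded_clinear (\<lambda>y. P y - f y *\<^sub>C x)"
        by (intro bounded_clinear_sub P(1) bounded_clinear_scaleC_const f(1))
      show "P (P y - f y *\<^sub>C x) - f (P y - f y *\<^sub>C x) *\<^sub>C x = P y - f y *\<^sub>C x" for y
        by (simp add: bounded_clinear_simps[OF P(1)] bounded_clinear_simps[OF f(1)] P(2) x(2) f(2,4)
            scaleC_complex_def)
      show "norm (P y - f y *\<^sub>C x) \<le> 3 ^ Suc n * norm y" for y
        using norm_triangle_ineq4[of "P y" "f y *\<^sub>C x"] P(3)[of y] f(3)[of y] x(1)
        by (simp add: norm_scaleC)
      show "\<forall>\<^sub>F y in ess. P y - f y *\<^sub>C x = y"
        using P(4) eventually_ess_kernel[OF f(1)] by eventually_elim simp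
    qed
  qed
  have "proj 0 (\<lambda>y. y)" unfolding proj_def by (simp add: bounded_clinear_ident)
  then have "\<exists>t. good 0 t" using extend by blast
  moreover have "\<exists>t'. good (Suc n) t' \<and> step t t'" if t: "good n t" for t n
  proof -
    obtain P x f where t_eq: "t = (P, x, f)" by (cases t) auto
    from extend[OF shrink[OF t[unfolded t_eq]]]
    obtain x' f' where "good (Suc n) (\<lambda>y. P y - f y *\<^sub>C x, x', f')" by blast
    then show ?thesis unfolding t_eq step_def by fastforce
  qed
  ultimately obtain t where t: "\<And>n. good n (t n) \<and> step (t n) (t (Suc n))"
    using dependent_nat_choice[of good "\<lambda>_. step"] by blast
  define P where "P n = fst (t n)" for n
  define x where "x n = fst (snd (t n))" for n
  define f where "f n = snd (snd (t n))" for n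
  have t_eq: "t n = (P n, x n, f n)" for n by (simp add: P_def x_def f_def)
  have good: "good n (P n, x n, f n)" for n using t[of n] by (simp add: t_eq)
  have P_Suc: "P (Suc n) y = P n y - f n y *\<^sub>C x n" for n y
    using t[of n] unfolding t_eq step_def by simp
  have P: "bounded_clinear (P n)" and x: "norm (x n) = 1" "P n (x n) = x n" "norm (S (x n)) < e n"
    and f: "bounded_clinear (f n)" "f n (x n) = 1" "cmod (f n y) \<le> 2 * 3 ^ n * norm y"
      "f n (P n y) = f n y" for n y
    using good[of n] unfolding good_def proj_def by simp_all
  have P_zero: "P m (x n) = 0" if "Suc n \<le> m" for m n
    using that
  proof (induction m rule: dec_induct)
    case base
    show ?case by (simp add: P_Suc x f(2) scaleC_one)
  next
    case (step m)
    have "f m (x n) = f m (P m (x n))" by (rule f(4)[symmetric])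
    also have "\<dots> = 0" unfolding step.IH by (rule bounded_clinear_simps(3)[OF f(1)])
    finally show ?case by (simp add: P_Suc step.IH)
  qed
  have f_P_zero: "f n (P m y) = 0" if "Suc n \<le> m" for m n y
    using that
  proof (induction m arbitrary: y rule: dec_induct)
    case base
    show ?case by (simp add: P_Suc bounded_clinear_simps[OF f(1)] f(2,4) scaleC_complex_def)
  next
    case (step m)
    have "f n (x m) = f n (P m (x m))" by (simp add: x(2))
    also have "\<dots> = 0" by (rule step.IH)
    finally show ?case
      by (simp add: P_Suc bounded_clinear_simps[OF f(1)] step.IH scaleC_complex_def)
  qed
  show thesis
  proof
    fix m n
    consider "m = n" | "Suc m \<le> n" | "Suc n \<le> m" by linarith
    then show "f m (x n) = (if m = n then 1 else 0)"
    proof cases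
      case 1
      then show ?thesis by (simp add: f(2))
    next
      case 2
      then show ?thesis using f_P_zero[OF 2, of "x n"] by (simp add: x(2))
    next
      case 3
      then show ?thesis
        using f(4)[of m "x n"] P_zero[OF 3] bounded_clinear_simps(3)[OF f(1)] by simp
    qed
  qed (use x f in auto)
qed

section \<open>Halfspaces of eigenvectors\<close>

lemma clinear_operators_iff: "T \<in> clinear_operators \<longleftrightarrow> bounded_clinear (blinfun_apply T)"
  unfolding clinear_operators_def bounded_clinear_def Vector_Spaces.linear_iff
  by (auto simp: complex_vector.vector_space_axioms blinfun.bounded_linear_right blinfun.add_right)

text \<open>The rank-one operators \<open>y \<mapsto> f n y *\<^sub>C v n\<close> have norms bounded by a geometric series, so their sum
converges in operator norm.\<close>

lemma small_biorthogonal_series: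
  fixes f :: "nat \<Rightarrow> 'a::complex_banach \<Rightarrow> complex" and v :: "nat \<Rightarrow> 'a"
  assumes f: "\<And>n. bounded_clinear (f n)"
    and small: "\<And>n y. cmod (f n y) * norm (v n) \<le> d * (1 / 2) ^ n * norm y" and d: "0 \<le> d"
  obtains K where "K \<in> clinear_operators" "norm K \<le> 2 * d"
    "\<And>y. blinfun_apply K y = (\<Sum>n. f n y *\<^sub>C v n)"
proof
  define k where "k n = Blinfun (\<lambda>y. f n y *\<^sub>C v n)" for n
  have k: "blinfun_apply (k n) y = f n y *\<^sub>C v n" for n y
    unfolding k_def
    by (subst bounded_linear_Blinfun_apply)
       (auto intro: bounded_clinear_bounded_linear bounded_clinear_scaleC_const f)
  have k_norm: "norm (k n) \<le> d * (1 / 2) ^ n" for n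
    by (rule norm_blinfun_bound) (use d small in \<open>simp_all add: k norm_scaleC\<close>)
  have geom: "summable (\<lambda>n. d * (1 / 2 :: real) ^ n)"
    by (intro summable_mult summable_geometric) simp
  have summable_k: "summable k"
    by (rule summable_comparison_test'[OF geom k_norm])
  have K: "blinfun_apply (suminf k) y = (\<Sum>n. f n y *\<^sub>C v n)" for y
    using bounded_linear.suminf[OF blinfun.bounded_linear_left summable_k, of y] by (simp add: k)
  then show "\<And>y. blinfun_apply (suminf k) y = (\<Sum>n. f n y *\<^sub>C v n)" .
  have "norm (suminf k) \<le> (\<Sum>n. d * (1 / 2) ^ n)" by (rule norm_suminf_le[OF k_norm geom])
  also have "\<dots> = 2 * d" by (simp add: suminf_mult suminf_geometric)
  finally show "norm (suminf k) \<le> 2 * d" .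
  have summable_ky: "summable (\<lambda>n. f n y *\<^sub>C v n)" for y
    using bounded_linear.summable[OF blinfun.bounded_linear_left summable_k, of y] by (simp add: k)
  have "blinfun_apply (suminf k) (c *\<^sub>C y) = c *\<^sub>C blinfun_apply (suminf k) y" for c y
    unfolding K bounded_linear.suminf[OF bounded_linear_scaleC summable_ky]
    by (simp add: bounded_clinear_scaleC[OF f] scaleC_complex_def scaleC_scaleC)
  then show "suminf k \<in> clinear_operators"
    unfolding clinear_operators_iff bounded_clinear_def
    by (simp add: blinfun.bounded_linear_right)
qed

text \<open>\<open>Y\<close> consists of the eigenvectors for \<open>l\<close> that are annihilated by all \<open>f n\<close> with odd index. It contains
the vectors \<open>x n\<close> with even index, while the odd functionals separate infinitely many directions
modulo \<open>Y\<close>. Defined by equations, it is closed without any appeal to closures of spans.\<close>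

lemma eigenvectors_halfspace:
  fixes S :: "'a::complex_normed_vector \<Rightarrow>\<^sub>L 'a" and f :: "nat \<Rightarrow> 'a \<Rightarrow> complex"
  assumes S: "S \<in> clinear_operators" and eigen: "\<And>n. blinfun_apply S (x n) = l *\<^sub>C x n"
    and f: "\<And>n. bounded_clinear (f n)" and fx: "\<And>m n. f m (x n) = (if m = n then 1 else 0)"
  obtains Y where "halfspace Y" "blinfun_apply S ` Y \<subseteq> Y"
proof
  have S': "bounded_clinear (\<lambda>y. blinfun_apply S y - l *\<^sub>C y)"
    using S unfolding clinear_operators_iff
    by (intro bounded_clinear_sub bounded_clinear_const_scaleC bounded_clinear_ident)
  define Y where "Y = {y. blinfun_apply S y - l *\<^sub>C y = 0} \<inter> (\<Inter>n. {y. f (2 * n + 1) y = 0})"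
  have sub: "csubspace Y"
    unfolding Y_def
    using csubspace_kernel[OF S'] csubspace_kernel[OF f]
    by (intro complex_vector.subspace_inter complex_vector.subspace_Inter) blast+
  have closed: "closed Y"
    unfolding Y_def by (intro closed_Int closed_INT ballI closed_kernel S' f)
  have even: "x (2 * n) \<in> Y" for n
  proof -
    have "2 * m + 1 \<noteq> 2 * n" for m by presburger
    then show ?thesis unfolding Y_def by (auto simp: eigen fx)
  qed
  have "\<not> finite_cdim Y"
  proof
    assume "finite_cdim Y"
    then obtain B where B: "finite B" "cspan B = Y" unfolding finite_cdim_def by blast
    have "\<not> range (\<lambda>n. x (2 * n)) \<subseteq> cspan B"
      by (rule biorthogonal_not_finitely_spanned[where f = "\<lambda>n. f (2 * n)", OF _ _ B(1)])
         (auto simp: f fx)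
    then show False using even B(2) by auto
  qed
  moreover have "\<not> finite_ccodim Y"
  proof
    assume "finite_ccodim Y"
    then obtain B where B: "finite B" "Y + cspan B = UNIV" unfolding finite_ccodim_def by blast
    have "\<exists>b\<in>cspan B. x (2 * n + 1) - b \<in> Y" for n
    proof -
      have "x (2 * n + 1) \<in> Y + cspan B" using B(2) by simp
      then obtain y b where "y \<in> Y" "b \<in> cspan B" "x (2 * n + 1) = y + b"
        by (rule set_plus_elim)
      then show ?thesis by (intro bexI[of _ b]) simp_all
    qed
    then obtain b where b: "\<And>n. b n \<in> cspan B" "\<And>n. x (2 * n + 1) - b n \<in> Y" by metis
    have "f (2 * m + 1) (b n) = (if m = n then 1 else 0)" for m n
    proof -
      have "f (2 * m + 1) (x (2 * n + 1) - b n) = 0" using b(2)[of n] unfolding Y_def by blast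
      then have "f (2 * m + 1) (b n) = f (2 * m + 1) (x (2 * n + 1))"
        by (simp add: bounded_clinear_simps[OF f])
      then show ?thesis by (simp add: fx)
    qed
    then have "\<not> range b \<subseteq> cspan B"
      by (intro biorthogonal_not_finitely_spanned[where f = "\<lambda>n. f (2 * n + 1)", OF _ _ B(1)] f)
    then show False using b(1) by auto
  qed
  ultimately show "halfspace Y" unfolding halfspace_def using sub closed by blast
  show "blinfun_apply S ` Y \<subseteq> Y"
  proof safe
    fix y assume y: "y \<in> Y"
    then have "blinfun_apply S y = l *\<^sub>C y" by (simp add: Y_def)
    then show "blinfun_apply S y \<in> Y" using complex_vector.subspace_scale[OF sub y] by simp
  qed
qed

lemma invariant_defect_0:
  fixes T :: "'a::complex_normed_vector \<Rightarrow>\<^sub>L 'a"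
  assumes "blinfun_apply T ` Y \<subseteq> Y"
  shows "almost_invariant T Y \<and> defect T Y = 0"
proof -
  have inv: "almost_invariant_with T Y (cspan {})"
    using assms unfolding almost_invariant_with_def finite_cdim_def
    by (auto simp: set_plus_def complex_vector.subspace_span)
  have "cdim (cspan {} :: 'a set) = 0"
    using complex_vector.dim_eq_card_independent[OF complex_vector.independent_empty]
    by (simp add: complex_vector.dim_span del: complex_vector.span_empty)
  then have "defect T Y \<le> 0"
    unfolding defect_def by (intro Least_le exI[of _ "cspan {}"] conjI inv)
  with inv show ?thesis unfolding almost_invariant_def by auto
qed

text \<open>The bound \<open>e / (8 * 6 ^ n)\<close> on the errors of the approximate eigenvectors absorbs the growth
\<open>2 * 3 ^ n\<close> of the functionals and leaves the terms \<open>e / 4 * (1 / 2) ^ n\<close>, whose sum is \<open>e / 2\<close>.\<close>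

theorem corollary4p4:
  assumes "\<not> finite_cdim (UNIV :: 'a::complex_banach set)"
  shows "(clinear_operators :: ('a \<Rightarrow>\<^sub>L 'a) set) \<subseteq>
    closure {T \<in> clinear_operators. \<exists>Y. halfspace Y \<and> almost_invariant T Y \<and> defect T Y \<le> 1}"
proof
  fix T :: "'a \<Rightarrow>\<^sub>L 'a" assume "T \<in> clinear_operators"
  then have T: "bounded_clinear (blinfun_apply T)" by (simp add: clinear_operators_iff)
  obtain l where l: "\<And>e. 0 < e \<Longrightarrow> \<exists>\<^sub>F x in ess. norm (l *\<^sub>C x - blinfun_apply T x) < e * norm x"
    using essential_approximate_eigenvalue[OF assms T] by blast
  have S: "bounded_clinear (\<lambda>x. l *\<^sub>C x - blinfun_apply T x)"
    by (intro bounded_clinear_sub bounded_clinear_const_scaleC bounded_clinear_ident T)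
  show "T \<in> closure {T \<in> clinear_operators.
      \<exists>Y. halfspace Y \<and> almost_invariant T Y \<and> defect T Y \<le> 1}"
    unfolding closure_approachable
  proof (intro allI impI)
    fix e :: real assume e: "0 < e"
    have e_pos: "0 < e / (8 * 6 ^ n)" for n :: nat using e by simp
    obtain x f where x: "\<And>n. norm (l *\<^sub>C x n - blinfun_apply T (x n)) < e / (8 * 6 ^ n)"
      and f: "\<And>n. bounded_clinear (f n)" "\<And>n y. cmod (f n y) \<le> 2 * 3 ^ n * norm y"
      and fx: "\<And>m n. f m (x n) = (if m = n then 1 else 0)"
      by (rule biorthogonal_small_sequence[where e = "\<lambda>n. e / (8 * 6 ^ n)", OF S _ e_pos])
         (rule l, assumption, rule that)
    define v where "v n = l *\<^sub>C x n - blinfun_apply T (x n)" for n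
    have small: "cmod (f n y) * norm (v n) \<le> e / 4 * (1 / 2) ^ n * norm y" for n y
    proof -
      have "cmod (f n y) * norm (v n) \<le> (2 * 3 ^ n * norm y) * (e / (8 * 6 ^ n))"
        unfolding v_def using f(2)[of n y] less_imp_le[OF x[of n]] by (intro mult_mono) auto
      also have "(6::real) ^ n = 3 ^ n * 2 ^ n" by (simp flip: power_mult_distrib)
      also have "(2 * 3 ^ n * norm y) * (e / (8 * (3 ^ n * 2 ^ n))) = e / 4 * (1 / 2) ^ n * norm y"
        by (simp add: field_simps)
      finally show ?thesis .
    qed
    have "0 \<le> e / 4" using e by simp
    from small_biorthogonal_series[OF f(1) small this]
    obtain K where K: "K \<in> clinear_operators" "norm K \<le> 2 * (e / 4)"
        "\<And>y. blinfun_apply K y = (\<Sum>n. f n y *\<^sub>C v n)"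
      by this (rule that)
    have "blinfun_apply K (x n) = v n" for n
    proof -
      have "blinfun_apply K (x n) = (\<Sum>m\<in>{n}. f m (x n) *\<^sub>C v m)"
        unfolding K(3) by (rule suminf_finite) (auto simp: fx)
      then show ?thesis by (simp add: fx scaleC_one)
    qed
    then have eigen: "blinfun_apply (T + K) (x n) = l *\<^sub>C x n" for n
      by (simp add: blinfun.add_left v_def)
    have "bounded_clinear (\<lambda>y. blinfun_apply T y + blinfun_apply K y)"
      using K(1) by (intro bounded_clinear_add T) (simp add: clinear_operators_iff)
    then have TK: "T + K \<in> clinear_operators"
      by (simp add: clinear_operators_iff plus_blinfun.rep_eq)
    obtain Y where "halfspace Y" "blinfun_apply (T + K) ` Y \<subseteq> Y"
      using eigenvectors_halfspace[OF TK eigen f(1) fx] by blast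
    then have "halfspace Y \<and> almost_invariant (T + K) Y \<and> defect (T + K) Y \<le> 1"
      using invariant_defect_0[of "T + K" Y] by simp
    moreover have "dist (T + K) T < e" using K(2) e by (simp add: dist_norm)
    ultimately show "\<exists>T'\<in>{T \<in> clinear_operators.
        \<exists>Y. halfspace Y \<and> almost_invariant T Y \<and> defect T Y \<le> 1}. dist T' T < e"
      using TK by blast
  qed
qed

end
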